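(* Let $F:[0,\infty)\to\mathcal{L}(\mathfrak{H})$ be a measurable family of non-negative self-adjoint contractions on a Hilbert space $\mathfrak{H}$ such that $F(0)=\mathds{1}$. For $\tau>0$ put $S(\tau):=(\mathds{1}-F(\tau))/\tau$, and let $H\ge0$ be a self-adjoint operator in $\mathfrak{H}$ such that $\operatorname{s-lim}_{\tau\to+0}(\mathds{1}+S(\tau))^{-1}=(\mathds{1}+H)^{-1}$. If for some $\rho\in(0,1]$ there is a constant $M_\rho>0$ such that $$\|(\mathds{1}+tS(\tau))^{-1}-(\mathds{1}+tH)^{-1}\|\le M_\rho\left(\frac{\tau}{t}\right)^{\rho}$$ holds for all $\tau,t\in(0,1]$ with $0<\tau\le t$, then for any bounded interval $\mathcal{I}\subset[0,\infty)$ there is a constant $c^{\mathcal{I}}_\rho>0$ such that $$\sup_{t\in\mathcal{I}}\|F(t/n)^n-e^{-tH}\|\le c^{\mathcal{I}}_\rho\,\frac{1}{n^\rho}$$ holds for all integers $n\ge1$.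
   Context: $\mathcal{L}(\mathfrak{H})$ is the space of bounded linear operators on $\mathfrak{H}$, $\|\cdot\|$ is the operator norm, $\mathds{1}$ is the identity operator, and $\operatorname{s-lim}$ denotes the limit in the strong operator topology. *)

theory Defs
  imports "HOL-Analysis.Analysis"
begin

text \<open>
  Complex Hilbert spaces. The inner product is antilinear in the first argument and linear in the
  second. The scalar multiplication extends the real one, so that bounded operators
  (\<open>'a \<Rightarrow>\<^sub>L 'a\<close>), their norm and the strong operator topology are those of the library.
\<close>

class complex_hilbert_space = banach +
  fixes scaleC :: "complex \<Rightarrow> 'a \<Rightarrow> 'a"  (infixr \<open>*\<^sub>C\<close> 75)
    and cinner :: "'a \<Rightarrow> 'a \<Rightarrow> complex"
  assumes scaleC_add_right: "c *\<^sub>C (x + y) = c *\<^sub>C x + c *\<^sub>C y"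
    and scaleC_add_left: "(c + d) *\<^sub>C x = c *\<^sub>C x + d *\<^sub>C x"
    and scaleC_scaleC: "c *\<^sub>C (d *\<^sub>C x) = (c * d) *\<^sub>C x"
    and scaleC_of_real: "complex_of_real r *\<^sub>C x = r *\<^sub>R x"
    and cinner_commute: "cinner x y = cnj (cinner y x)"
    and cinner_add_right: "cinner x (y + z) = cinner x y + cinner x z"
    and cinner_scaleC_right: "cinner x (c *\<^sub>C y) = c * cinner x y"
    and cinner_self: "cinner x x = complex_of_real ((norm x)\<^sup>2)"

text \<open>
  A possibly unbounded operator is given by its domain \<open>D\<close> and a map \<open>A\<close> whose values outside \<open>D\<close>
  are irrelevant. Bounded operators have domain \<^term>\<open>UNIV\<close>.
\<close>

definition linear_operator :: "'a::complex_hilbert_space set \<Rightarrow> ('a \<Rightarrow> 'a) \<Rightarrow> bool" where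
  "linear_operator D A \<longleftrightarrow>
     0 \<in> D \<and> (\<forall>x\<in>D. \<forall>y\<in>D. x + y \<in> D \<and> A (x + y) = A x + A y) \<and>
     (\<forall>c. \<forall>x\<in>D. c *\<^sub>C x \<in> D \<and> A (c *\<^sub>C x) = c *\<^sub>C A x)"

definition operator_graph :: "'a set \<Rightarrow> ('a \<Rightarrow> 'a) \<Rightarrow> ('a \<times> 'a) set" where
  "operator_graph D A = {(x, A x) | x. x \<in> D}"

definition adjoint_graph :: "'a::complex_hilbert_space set \<Rightarrow> ('a \<Rightarrow> 'a) \<Rightarrow> ('a \<times> 'a) set" where
  "adjoint_graph D A = {(y, z). \<forall>x\<in>D. cinner y (A x) = cinner z x}"

definition self_adjoint :: "'a::complex_hilbert_space set \<Rightarrow> ('a \<Rightarrow> 'a) \<Rightarrow> bool" where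
  "self_adjoint D A \<longleftrightarrow>
     linear_operator D A \<and> closure D = UNIV \<and> adjoint_graph D A = operator_graph D A"

definition nonneg_operator :: "'a::complex_hilbert_space set \<Rightarrow> ('a \<Rightarrow> 'a) \<Rightarrow> bool" where
  "nonneg_operator D A \<longleftrightarrow> (\<forall>x\<in>D. cinner x (A x) \<in> \<real>\<^sub>\<ge>\<^sub>0)"

definition bounded_inverse :: "'a::complex_hilbert_space set \<Rightarrow> ('a \<Rightarrow> 'a) \<Rightarrow> ('a \<Rightarrow>\<^sub>L 'a)" where
  "bounded_inverse D A =
     (THE B. (\<forall>y. blinfun_apply B y \<in> D \<and> A (blinfun_apply B y) = y) \<and>
             (\<forall>x\<in>D. blinfun_apply B (A x) = x))"

definition blinfun_power :: "('a::real_normed_vector \<Rightarrow>\<^sub>L 'a) \<Rightarrow> nat \<Rightarrow> ('a \<Rightarrow>\<^sub>L 'a)" where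
  "blinfun_power B n = ((\<lambda>C. B o\<^sub>L C) ^^ n) id_blinfun"

definition C0_semigroup :: "(real \<Rightarrow> ('a::complex_hilbert_space \<Rightarrow>\<^sub>L 'a)) \<Rightarrow> bool" where
  "C0_semigroup T \<longleftrightarrow>
     (\<forall>t\<ge>0. linear_operator UNIV (blinfun_apply (T t))) \<and>
     T 0 = id_blinfun \<and>
     (\<forall>s\<ge>0. \<forall>t\<ge>0. T (s + t) = T s o\<^sub>L T t) \<and>
     (\<forall>x. ((\<lambda>t. blinfun_apply (T t) x) \<longlongrightarrow> x) (at_right 0))"

definition generator_graph :: "(real \<Rightarrow> ('a::complex_hilbert_space \<Rightarrow>\<^sub>L 'a)) \<Rightarrow> ('a \<times> 'a) set" where
  "generator_graph T =
     {(x, y). ((\<lambda>h. (1 / h) *\<^sub>R (blinfun_apply (T h) x - x)) \<longlongrightarrow> y) (at_right 0)}"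

text \<open>
  \<open>exp_minus D A t\<close> is $e^{-tA}$, $t \ge 0$: the value at \<open>t\<close> of the strongly continuous semigroup
  generated by $-A$. Only the value at \<open>t\<close> is described, since the values of a semigroup at negative
  times are not determined.
\<close>

definition exp_minus :: "'a::complex_hilbert_space set \<Rightarrow> ('a \<Rightarrow> 'a) \<Rightarrow> real \<Rightarrow> ('a \<Rightarrow>\<^sub>L 'a)" where
  "exp_minus D A t =
     (THE B. \<exists>T. C0_semigroup T \<and> generator_graph T = operator_graph D (\<lambda>x. - A x) \<and> B = T t)"

text \<open>
  Measurability of an operator-valued function on $[0,\infty)$: all matrix elements are Lebesgue
  measurable.
\<close>

definition measurable_family :: "(real \<Rightarrow> ('a::complex_hilbert_space \<Rightarrow>\<^sub>L 'a)) \<Rightarrow> bool" where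
  "measurable_family F \<longleftrightarrow>
     (\<forall>x y. (\<lambda>t. cinner x (blinfun_apply (F t) y)) \<in> borel_measurable (lebesgue_on {0..}))"

end

theory Submission
  imports Defs
begin

text \<open>
  The proof is a telescoping argument for operator powers; it uses neither the spectral theorem nor contour
  integrals. Let \<open>F\<close> and \<open>G\<close> be operators between \<open>0\<close> and \<open>1\<close>. The powers are controlled by the
  resolvents of the discrete generators \<open>n (1 - F)\<close> and \<open>n (1 - G)\<close>:

    \<open>\<parallel>F ^ n - G ^ n\<parallel> \<le> 54 \<parallel>(1 + n (1 - F))\<^sup>-\<^sup>1 - (1 + n (1 - G))\<^sup>-\<^sup>1\<parallel>\<close>

  with a constant that does not depend on \<open>n\<close> (\<open>norm_power_diff_le_resolvent_diff\<close>). The reason is the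
  discrete analogue of the smoothing property of a holomorphic semigroup: \<open>F ^ j (1 - F)\<close> has norm at
  most \<open>1 / (j + 1)\<close>, so that the factors \<open>1 + n (1 - F)\<close> which turn a difference of generators into
  a difference of resolvents are absorbed by a power \<open>F ^ j\<close> whose exponent is comparable to \<open>n\<close>.

  For \<open>F = F(t / n)\<close> one has \<open>n (1 - F(t / n)) = t S(t / n)\<close>, whose resolvent the hypothesis compares with
  \<open>J t = (1 + t H)\<^sup>-\<^sup>1\<close>. As \<open>G\<close> one takes \<open>J (t / n)\<close>, one step of the implicit Euler scheme for \<open>H\<close>. The
  resolvent of \<open>n (1 - J (t / n))\<close> differs from \<open>J t\<close> by at most \<open>1 / n\<close>, and the same is
  true if the step \<open>J (t / n)\<close> is replaced by \<open>m\<close> steps of length \<open>t / (n m)\<close>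
  (\<open>norm_resolvent_step_diff\<close>). By the inequality for powers the Euler approximations \<open>J (t / n) ^ n\<close> therefore
  form a Cauchy sequence in norm with error \<open>O(1 / n)\<close>, and their limit is the semigroup
  \<open>e\<^sup>-\<^sup>t\<^sup>H\<close>: it is a strongly continuous semigroup with generator \<open>- H\<close>, and it is the only one
  (\<open>exp_minus_eq_T\<close>). Since \<open>1 / n \<le> n\<^sup>-\<^sup>\<rho>\<close>, this proves the estimate for \<open>t \<le> 1\<close>.

  For larger \<open>t\<close> the resolvents at \<open>t\<close> are estimated by those at \<open>1\<close>
  (\<open>norm_resolvent_diff_rescale\<close>) as long as \<open>t / n \<le> 1\<close>, and for the finitely many remaining \<open>n\<close>
  the difference of two contractions is at most \<open>2\<close>.
\<close>

section \<open>The algebra of bounded operators\<close>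

text \<open>
  A copy of the bounded operators in which composition is a multiplication, so that the ring
  identities and the powers of the library apply. It is not a \<^class>\<open>real_normed_algebra_1\<close>: on the
  zero space \<open>0 = 1\<close>.
\<close>

typedef (overloaded) 'a endo = "UNIV :: ('a::real_normed_vector \<Rightarrow>\<^sub>L 'a) set"
  morphisms blin endo ..

setup_lifting type_definition_endo

instantiation endo :: (real_normed_vector) real_normed_algebra
begin

lift_definition zero_endo :: "'a endo" is 0 .
lift_definition plus_endo :: "'a endo \<Rightarrow> 'a endo \<Rightarrow> 'a endo" is "(+)" .
lift_definition minus_endo :: "'a endo \<Rightarrow> 'a endo \<Rightarrow> 'a endo" is "(-)" .
lift_definition uminus_endo :: "'a endo \<Rightarrow> 'a endo" is uminus .
lift_definition scaleR_endo :: "real \<Rightarrow> 'a endo \<Rightarrow> 'a endo" is scaleR .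
lift_definition times_endo :: "'a endo \<Rightarrow> 'a endo \<Rightarrow> 'a endo" is "(o\<^sub>L)" .
lift_definition norm_endo :: "'a endo \<Rightarrow> real" is norm .
definition sgn_endo :: "'a endo \<Rightarrow> 'a endo" where "sgn_endo x = scaleR (inverse (norm x)) x"
definition dist_endo :: "'a endo \<Rightarrow> 'a endo \<Rightarrow> real" where "dist_endo x y = norm (x - y)"
definition uniformity_endo :: "('a endo \<times> 'a endo) filter" where
  "uniformity_endo = (INF e\<in>{0<..}. principal {(x, y). dist x y < e})"
definition open_endo :: "'a endo set \<Rightarrow> bool" where
  "open_endo U \<longleftrightarrow> (\<forall>x\<in>U. \<forall>\<^sub>F (x', y) in uniformity. x' = x \<longrightarrow> y \<in> U)"

instance
proof
  fix x y z :: "'a endo" and a b :: real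
  show "x + y + z = x + (y + z)" "x + y = y + x" "0 + x = x" "- x + x = 0" "x - y = x + - y"
    by (transfer, simp)+
  show "a *\<^sub>R (x + y) = a *\<^sub>R x + a *\<^sub>R y" "(a + b) *\<^sub>R x = a *\<^sub>R x + b *\<^sub>R x"
    "a *\<^sub>R b *\<^sub>R x = (a * b) *\<^sub>R x" "1 *\<^sub>R x = x"
    by (transfer, simp add: scaleR_add_right scaleR_add_left)+
  show "x * y * z = x * (y * z)" "(x + y) * z = x * z + y * z" "x * (y + z) = x * y + x * z"
    "a *\<^sub>R x * y = a *\<^sub>R (x * y)" "x * a *\<^sub>R y = a *\<^sub>R (x * y)"
    by (transfer, auto intro!: blinfun_eqI simp: blinfun.bilinear_simps)+
  show "norm x = 0 \<longleftrightarrow> x = 0" by transfer simp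
  show "norm (x + y) \<le> norm x + norm y" by transfer (rule norm_triangle_ineq)
  show "norm (a *\<^sub>R x) = \<bar>a\<bar> * norm x" by transfer simp
  show "norm (x * y) \<le> norm x * norm y" by transfer (rule norm_blinfun_compose)
qed (simp_all add: sgn_endo_def dist_endo_def uniformity_endo_def open_endo_def)

end

instantiation endo :: (real_normed_vector) monoid_mult
begin

lift_definition one_endo :: "'a endo" is id_blinfun .

instance by standard (transfer, auto intro!: blinfun_eqI)+

end

instance endo :: (banach) banach
proof
  fix X :: "nat \<Rightarrow> 'a endo"
  assume "Cauchy X"
  have nb: "norm (blin a - blin b) = norm (a - b)" for a b :: "'a endo"
    by transfer simp
  have "Cauchy (\<lambda>n. blin (X n))"
    using \<open>Cauchy X\<close> by (simp add: Cauchy_def dist_norm nb)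
  then obtain L where L: "(\<lambda>n. blin (X n)) \<longlonglongrightarrow> L"
    by (auto simp: Cauchy_convergent_iff convergent_def)
  have "X \<longlonglongrightarrow> endo L"
    using L by (simp add: lim_sequentially dist_norm nb[symmetric] endo_inverse)
  then show "convergent X" by (auto simp: convergent_def)
qed

definition app :: "'a::real_normed_vector endo \<Rightarrow> 'a \<Rightarrow> 'a" where
  "app A = blinfun_apply (blin A)"

lemma endo_eqI: "(\<And>x. app A x = app B x) \<Longrightarrow> A = B"
  unfolding app_def by transfer (rule blinfun_eqI)

lemma app_mult [simp]: "app (A * B) x = app A (app B x)"
  unfolding app_def by transfer simp

lemma app_one [simp]: "app 1 x = x"
  unfolding app_def by transfer simp

lemma norm_app: "norm (app A x) \<le> norm A * norm x"
  unfolding app_def by transfer (rule norm_blinfun)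

lemma norm_endo_bound: "0 \<le> b \<Longrightarrow> (\<And>x. norm (app A x) \<le> b * norm x) \<Longrightarrow> norm A \<le> b"
  unfolding app_def by transfer (rule norm_blinfun_bound)

interpretation app: bounded_bilinear app
proof
  fix A B :: "'a::real_normed_vector endo" and x y :: 'a and r :: real
  show "app (A + B) x = app A x + app B x" "app (r *\<^sub>R A) x = r *\<^sub>R app A x"
    unfolding app_def by (transfer, simp add: blinfun.bilinear_simps)+
  show "app A (x + y) = app A x + app A y" "app A (r *\<^sub>R x) = r *\<^sub>R app A x"
    unfolding app_def by (simp_all add: blinfun.bilinear_simps)
  show "\<exists>K. \<forall>A (x::'a). norm (app A x) \<le> norm A * norm x * K"
    by (auto intro!: exI[where x=1] norm_app)
qed

lemmas app_simps = app.add_left app.add_right app.diff_left app.diff_right app.minus_left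
  app.minus_right app.scaleR_left app.scaleR_right app.zero_left app.zero_right

lemma norm_one_endo_le: "norm (1 :: 'a::real_normed_vector endo) \<le> 1"
  by (rule norm_endo_bound) simp_all

lemma norm_mult_le:
  fixes A B :: "'a::real_normed_vector endo"
  shows "norm A \<le> a \<Longrightarrow> norm B \<le> b \<Longrightarrow> norm (A * B) \<le> a * b"
  by (meson mult_mono' norm_ge_zero norm_mult_ineq order_trans)

lemma norm_mult_le_left:
  fixes A B :: "'a::real_normed_vector endo"
  shows "norm A \<le> 1 \<Longrightarrow> norm B \<le> b \<Longrightarrow> norm (A * B) \<le> b"
  using norm_mult_le[of A 1 B b] by simp

lemma norm_mult_le_right:
  fixes A B :: "'a::real_normed_vector endo"
  shows "norm A \<le> a \<Longrightarrow> norm B \<le> 1 \<Longrightarrow> norm (A * B) \<le> a"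
  using norm_mult_le[of A a B 1] by simp

lemma norm_power_endo_le:
  fixes A :: "'a::real_normed_vector endo"
  assumes "norm A \<le> 1"
  shows "norm (A ^ n) \<le> 1"
proof (induction n)
  case 0
  then show ?case by (simp add: norm_one_endo_le)
next
  case (Suc n)
  then show ?case using norm_mult_le_left[OF assms Suc] by simp
qed

lemma blin_power: "blin (A ^ n) = blinfun_power (blin A) n"
proof (induction n)
  case 0
  show ?case by (simp add: blinfun_power_def one_endo.rep_eq)
next
  case (Suc n)
  then show ?case by (simp add: blinfun_power_def times_endo.rep_eq)
qed

lemma power_comm_mult:
  fixes A B :: "'a::monoid_mult"
  assumes "A * B = B * A"
  shows "A ^ n * B = B * A ^ n"
proof (induction n)
  case (Suc n)
  have "A ^ Suc n * B = A * (A ^ n * B)" by (simp add: mult.assoc)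
  also have "\<dots> = A * B * A ^ n" by (simp add: Suc mult.assoc)
  also have "\<dots> = B * A ^ Suc n" by (simp add: assms mult.assoc)
  finally show ?case .
qed simp

section \<open>The inner product\<close>

definition rin :: "'a::complex_hilbert_space \<Rightarrow> 'a \<Rightarrow> real" where
  "rin x y = Re (cinner x y)"

lemma cinner_zero_right [simp]: "cinner (x::'a::complex_hilbert_space) 0 = 0"
  using cinner_add_right[of x 0 0] by simp

lemma cinner_zero_left [simp]: "cinner 0 (x::'a::complex_hilbert_space) = 0"
  by (subst cinner_commute) simp

lemma cinner_add_left: "cinner ((x::'a::complex_hilbert_space) + y) z = cinner x z + cinner y z"
  by (subst (1 2 3) cinner_commute) (simp add: cinner_add_right)

lemma cinner_scaleR_right: "cinner (x::'a::complex_hilbert_space) (r *\<^sub>R y) = r *\<^sub>R cinner x y"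
  by (simp flip: scaleC_of_real add: cinner_scaleC_right scaleR_conv_of_real)

lemma cinner_scaleR_left: "cinner (r *\<^sub>R (x::'a::complex_hilbert_space)) y = r *\<^sub>R cinner x y"
  by (subst (1 2) cinner_commute) (simp add: cinner_scaleR_right)

lemma cinner_scaleC_left: "cinner (c *\<^sub>C (x::'a::complex_hilbert_space)) y = cnj c * cinner x y"
  by (subst (1 2) cinner_commute) (simp add: cinner_scaleC_right)

lemma cinner_minus_right: "cinner (x::'a::complex_hilbert_space) (- y) = - cinner x y"
  using cinner_scaleR_right[of x "-1" y] by simp

lemma cinner_minus_left: "cinner (- (x::'a::complex_hilbert_space)) y = - cinner x y"
  using cinner_scaleR_left[of "-1" x y] by simp

lemma cinner_diff_right: "cinner (x::'a::complex_hilbert_space) (y - z) = cinner x y - cinner x z"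
  using cinner_add_right[of x y "- z"] by (simp add: cinner_minus_right)

lemma cinner_diff_left: "cinner ((x::'a::complex_hilbert_space) - y) z = cinner x z - cinner y z"
  using cinner_add_left[of x "- y" z] by (simp add: cinner_minus_left)

lemma rin_simps:
  fixes x y z :: "'a::complex_hilbert_space"
  shows "rin x (y + z) = rin x y + rin x z" "rin (x + y) z = rin x z + rin y z"
    "rin x (y - z) = rin x y - rin x z" "rin (x - y) z = rin x z - rin y z"
    "rin x (r *\<^sub>R y) = r * rin x y" "rin (r *\<^sub>R x) y = r * rin x y"
    "rin x (- y) = - rin x y" "rin (- x) y = - rin x y" "rin x 0 = 0" "rin 0 y = 0"
  by (simp_all add: rin_def cinner_add_right cinner_add_left cinner_diff_right cinner_diff_left
      cinner_scaleR_right cinner_scaleR_left cinner_minus_right cinner_minus_left)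

lemma rin_commute: "rin x y = rin y x"
  unfolding rin_def by (subst cinner_commute) simp

lemma rin_self: "rin x x = (norm x)\<^sup>2"
  by (simp add: rin_def cinner_self)

text \<open>
  The discriminant argument, used for the Cauchy-Schwarz inequality of a semidefinite form and, with
  \<open>a = 0\<close>, for the orthogonality of a minimiser.
\<close>

lemma discriminant_le:
  fixes a b c :: real
  assumes "0 \<le> c" and nonneg: "\<And>t. 0 \<le> a + 2 * t * b + t\<^sup>2 * c"
  shows "b\<^sup>2 \<le> a * c"
proof (cases "c = 0")
  case True
  have "b = 0"
  proof (rule ccontr)
    assume "b \<noteq> 0"
    then show False using nonneg[of "- (a + 1) / (2 * b)"] True by (simp add: field_simps)
  qed
  then show ?thesis using True by simp
next
  case False
  then have "0 < c" using assms(1) by simp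
  have "0 \<le> (a + 2 * (- b / c) * b + (- b / c)\<^sup>2 * c) * c"
    using nonneg[of "- b / c"] \<open>0 < c\<close> by (intro mult_nonneg_nonneg) auto
  also have "\<dots> = a * c - b\<^sup>2" using \<open>0 < c\<close> by (simp add: field_simps power2_eq_square)
  finally show ?thesis by simp
qed

lemma rin_le_norm: "\<bar>rin x y\<bar> \<le> norm x * norm y"
proof -
  have "(rin x y)\<^sup>2 \<le> rin x x * rin y y"
  proof (rule discriminant_le)
    fix t
    have "rin x x + 2 * t * rin x y + t\<^sup>2 * rin y y = rin (x + t *\<^sub>R y) (x + t *\<^sub>R y)"
      by (simp add: rin_simps rin_commute[of y x] algebra_simps power2_eq_square)
    then show "0 \<le> rin x x + 2 * t * rin x y + t\<^sup>2 * rin y y" by (simp add: rin_self)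
  qed (simp add: rin_self)
  then have "(rin x y)\<^sup>2 \<le> (norm x * norm y)\<^sup>2" by (simp add: rin_self power_mult_distrib)
  then show ?thesis by (simp add: abs_le_square_iff[symmetric])
qed

lemma norm_scaleC: "norm (c *\<^sub>C (x::'a::complex_hilbert_space)) = cmod c * norm x"
proof -
  have "complex_of_real ((norm (c *\<^sub>C x))\<^sup>2) = cnj c * c * complex_of_real ((norm x)\<^sup>2)"
    by (simp only: cinner_self[symmetric] cinner_scaleC_left cinner_scaleC_right mult_ac)
  also have "\<dots> = complex_of_real ((cmod c * norm x)\<^sup>2)"
    by (simp add: power_mult_distrib mult.commute[of "cnj c"] flip: complex_norm_square)
  finally have "(norm (c *\<^sub>C x))\<^sup>2 = (cmod c * norm x)\<^sup>2" by (simp only: of_real_eq_iff)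
  then show ?thesis by (simp add: power2_eq_iff_nonneg)
qed

lemma Im_cinner: "Im (cinner x y) = - rin x (\<i> *\<^sub>C y)"
  by (simp add: rin_def cinner_scaleC_right)

text \<open>
  The imaginary part of \<open>cinner x y\<close> is \<open>- rin x (\<i> *\<^sub>C y)\<close>, so that a bound for the real part suffices.
\<close>

interpretation cinner: bounded_bilinear "cinner :: 'a::complex_hilbert_space \<Rightarrow> 'a \<Rightarrow> complex"
proof
  show "\<exists>K. \<forall>x y::'a. norm (cinner x y) \<le> norm x * norm y * K"
  proof (intro exI[where x=2] allI)
    fix x y :: 'a
    have "norm (cinner x y) \<le> \<bar>Re (cinner x y)\<bar> + \<bar>Im (cinner x y)\<bar>" by (rule cmod_le)
    also have "\<dots> \<le> norm x * norm y + norm x * norm y"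
      using rin_le_norm[of x y] rin_le_norm[of x "\<i> *\<^sub>C y"]
      by (simp add: Im_cinner norm_scaleC) (simp add: rin_def)
    finally show "norm (cinner x y) \<le> norm x * norm y * 2" by simp
  qed
qed (simp_all add: cinner_add_right cinner_add_left cinner_scaleR_right cinner_scaleR_left)

lemma tendsto_rin [tendsto_intros]:
  assumes "(f \<longlongrightarrow> a) F" "(g \<longlongrightarrow> b) F"
  shows "((\<lambda>x. rin (f x) (g x)) \<longlongrightarrow> rin a b) F"
  unfolding rin_def by (intro tendsto_Re cinner.tendsto assms)

lemma cinner_eqI: "(\<And>z. cinner z x = cinner z y) \<Longrightarrow> x = y"
proof -
  assume "\<And>z. cinner z x = cinner z y"
  then have "cinner (x - y) (x - y) = 0" by (simp add: cinner_diff_right)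
  then show "x = y" by (simp add: cinner_self)
qed

section \<open>Positive operators\<close>

definition hermitian :: "'a::complex_hilbert_space endo \<Rightarrow> bool" where
  "hermitian A \<longleftrightarrow> (\<forall>x y. cinner (app A x) y = cinner x (app A y))"

definition pos_op :: "'a::complex_hilbert_space endo \<Rightarrow> bool" where
  "pos_op A \<longleftrightarrow> hermitian A \<and> (\<forall>x. 0 \<le> rin x (app A x))"

lemma hermitianD: "hermitian A \<Longrightarrow> cinner (app A x) y = cinner x (app A y)"
  by (simp add: hermitian_def)

lemma hermitian_rin: "hermitian A \<Longrightarrow> rin (app A x) y = rin x (app A y)"
  by (simp add: hermitian_def rin_def)

lemma positive_hermitian: "pos_op A \<Longrightarrow> hermitian A"
  by (simp add: pos_op_def)

lemma positiveD: "pos_op A \<Longrightarrow> 0 \<le> rin x (app A x)"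
  by (simp add: pos_op_def)

lemma hermitian_simple [simp]: "hermitian 0" "hermitian 1"
  by (simp_all add: hermitian_def app_simps)

lemma hermitian_add: "hermitian A \<Longrightarrow> hermitian B \<Longrightarrow> hermitian (A + B)"
  by (simp add: hermitian_def app_simps cinner_add_left cinner_add_right)

lemma hermitian_diff: "hermitian A \<Longrightarrow> hermitian B \<Longrightarrow> hermitian (A - B)"
  by (simp add: hermitian_def app_simps cinner_diff_left cinner_diff_right)

lemma hermitian_scaleR: "hermitian A \<Longrightarrow> hermitian (c *\<^sub>R A)"
  by (simp add: hermitian_def app_simps cinner_scaleR_left cinner_scaleR_right)

lemma hermitian_mult: "hermitian A \<Longrightarrow> hermitian B \<Longrightarrow> A * B = B * A \<Longrightarrow> hermitian (A * B)"
  unfolding hermitian_def by (metis app_mult)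

lemma hermitian_power: "hermitian A \<Longrightarrow> hermitian (A ^ n)"
  by (induction n) (auto intro!: hermitian_mult simp: power_commutes)

lemma hermitian_sandwich: "hermitian A \<Longrightarrow> hermitian C \<Longrightarrow> hermitian (C * A * C)"
  by (simp add: hermitian_def)

text \<open>
  The elements of \<^typ>\<open>'a endo\<close> are real linear. Symmetry forces complex linearity: in
  \<open>cinner z (app A (c *\<^sub>C x))\<close> the operator can be moved to \<open>z\<close> and back.
\<close>

lemma hermitian_scaleC:
  assumes "hermitian A"
  shows "app A (c *\<^sub>C x) = c *\<^sub>C app A x"
  by (rule cinner_eqI)
     (simp add: hermitianD[OF assms, symmetric] cinner_scaleC_right)

lemma hermitian_limit:
  assumes "\<And>n. hermitian (X n)" "X \<longlonglongrightarrow> A"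
  shows "hermitian A"
  unfolding hermitian_def
proof (intro allI)
  fix x y
  have "(\<lambda>n. cinner (app (X n) x) y) \<longlonglongrightarrow> cinner (app A x) y"
    by (intro cinner.tendsto app.tendsto assms tendsto_const)
  moreover have "(\<lambda>n. cinner x (app (X n) y)) \<longlonglongrightarrow> cinner x (app A y)"
    by (intro cinner.tendsto app.tendsto assms tendsto_const)
  ultimately show "cinner (app A x) y = cinner x (app A y)"
    using assms(1) by (metis (no_types, lifting) LIMSEQ_unique ext hermitianD)
qed

lemma positive_simple [simp]: "pos_op 0" "pos_op 1"
  by (simp_all add: pos_op_def app_simps rin_simps rin_self)

lemma positive_add: "pos_op A \<Longrightarrow> pos_op B \<Longrightarrow> pos_op (A + B)"
  by (simp add: pos_op_def hermitian_add app_simps rin_simps)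

lemma positive_scaleR: "pos_op A \<Longrightarrow> 0 \<le> c \<Longrightarrow> pos_op (c *\<^sub>R A)"
  by (simp add: pos_op_def hermitian_scaleR app_simps rin_simps)

lemma positive_sum: "(\<And>i. i \<in> I \<Longrightarrow> pos_op (f i)) \<Longrightarrow> pos_op (\<Sum>i\<in>I. f i)"
  by (induction I rule: infinite_finite_induct) (auto intro: positive_add)

lemma positive_sandwich: "pos_op A \<Longrightarrow> hermitian C \<Longrightarrow> pos_op (C * A * C)"
  unfolding pos_op_def using hermitian_sandwich[of A C] by (simp flip: hermitian_rin[of C])

lemma positive_square: "hermitian C \<Longrightarrow> pos_op (C * C)"
  using positive_sandwich[of 1 C] by simp

text \<open>The Cauchy-Schwarz inequality for the semidefinite form \<open>(x, y) \<mapsto> rin x (app A y)\<close>.\<close>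

lemma positive_Cauchy_Schwarz:
  assumes "pos_op A"
  shows "(rin x (app A y))\<^sup>2 \<le> rin x (app A x) * rin y (app A y)"
proof (rule discriminant_le)
  fix t
  have "rin y (app A x) = rin x (app A y)"
    using hermitian_rin[OF positive_hermitian[OF assms], of y x] by (simp add: rin_commute)
  then have "rin x (app A x) + 2 * t * rin x (app A y) + t\<^sup>2 * rin y (app A y)
      = rin (x + t *\<^sub>R y) (app A (x + t *\<^sub>R y))"
    by (simp add: rin_simps app_simps algebra_simps power2_eq_square)
  then show "0 \<le> rin x (app A x) + 2 * t * rin x (app A y) + t\<^sup>2 * rin y (app A y)"
    using positiveD[OF assms] by simp
qed (rule positiveD[OF assms])

lemma norm_le_if_positive:
  assumes "pos_op A" "pos_op (c *\<^sub>R 1 - A)" "0 \<le> c"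
  shows "norm A \<le> c"
proof (rule norm_endo_bound[OF \<open>0 \<le> c\<close>])
  fix x
  have upper: "rin y (app A y) \<le> c * (norm y)\<^sup>2" for y
    using positiveD[OF assms(2), of y] by (simp add: app_simps rin_simps rin_self)
  let ?y = "app A x"
  have "(rin ?y ?y)\<^sup>2 \<le> rin ?y (app A ?y) * rin x (app A x)"
    by (rule positive_Cauchy_Schwarz[OF assms(1)])
  also have "\<dots> \<le> (c * (norm ?y)\<^sup>2) * (c * (norm x)\<^sup>2)"
    using upper positiveD[OF assms(1)] assms(3) by (intro mult_mono) auto
  finally have *: "(norm ?y)\<^sup>2 * (norm ?y)\<^sup>2 \<le> (norm ?y)\<^sup>2 * (c * norm x)\<^sup>2"
    by (simp add: rin_self power2_eq_square mult_ac)
  show "norm ?y \<le> c * norm x"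
  proof (cases "?y = 0")
    case False
    then have "0 < (norm ?y)\<^sup>2" by simp
    then have "(norm ?y)\<^sup>2 \<le> (c * norm x)\<^sup>2" using * by (rule mult_left_le_imp_le[rotated])
    then show ?thesis using assms(3) by (simp add: power2_le_iff_abs_le)
  qed (use assms(3) in simp)
qed

lemma positive_minus_if_norm_le:
  assumes "hermitian A" "norm A \<le> c"
  shows "pos_op (c *\<^sub>R 1 - A)"
  unfolding pos_op_def
proof (intro conjI allI)
  fix x
  have "rin x (app A x) \<le> norm x * norm (app A x)" using rin_le_norm[of x "app A x"] by simp
  also have "\<dots> \<le> norm x * (c * norm x)"
    using norm_app[of A x] assms(2) by (intro mult_left_mono) (auto elim!: order_trans intro: mult_right_mono)
  finally show "0 \<le> rin x (app (c *\<^sub>R 1 - A) x)"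
    by (simp add: app_simps rin_simps rin_self power2_eq_square mult_ac)
qed (intro hermitian_diff hermitian_scaleR assms hermitian_simple)

text \<open>
  If \<open>0 \<le> A \<le> 1\<close>, then the iteration \<open>A\<^sub>k\<^sub>+\<^sub>1 = A\<^sub>k - A\<^sub>k\<^sup>2\<close> stays between \<open>0\<close> and \<open>1\<close> and the partial
  sums of \<open>A\<^sub>k\<^sup>2\<close> telescope to \<open>A\<close>. Hence \<open>A B\<close> is a strongly convergent sum of operators \<open>A\<^sub>k B A\<^sub>k\<close>, which replaces the
  square root of \<open>A\<close> in the usual argument.
\<close>

lemma positive_mult_contraction:
  assumes A: "pos_op A" "pos_op (1 - A)" and B: "pos_op B" and AB: "A * B = B * A"
  shows "pos_op (A * B)"
proof -
  define a where "a k = ((\<lambda>X. X - X * X) ^^ k) A" for k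
  have a_Suc: "a (Suc k) = a k - a k * a k" and a_0: "a 0 = A" for k
    by (simp_all add: a_def)
  have a_pos: "pos_op (a k) \<and> pos_op (1 - a k)" for k
  proof (induction k)
    case (Suc k)
    let ?X = "a k"
    have s: "hermitian ?X" "hermitian (1 - ?X)" using Suc by (auto intro: positive_hermitian)
    have "pos_op (?X * (1 - ?X) * ?X + (1 - ?X) * ?X * (1 - ?X))" "pos_op ((1 - ?X) + ?X * ?X)"
      using Suc s by (auto intro!: positive_add positive_sandwich positive_square)
    moreover have "a (Suc k) = ?X * (1 - ?X) * ?X + (1 - ?X) * ?X * (1 - ?X)"
      by (simp add: a_Suc algebra_simps)
    moreover have "1 - a (Suc k) = (1 - ?X) + ?X * ?X"
      by (simp add: a_Suc)
    ultimately show ?case by metis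
  qed (simp add: a_0 A)
  have comm: "a k * B = B * a k" for k
  proof (induction k)
    case (Suc k)
    have "a k * a k * B = B * (a k * a k)" by (metis Suc mult.assoc)
    then show ?case using Suc by (simp add: a_Suc left_diff_distrib right_diff_distrib)
  qed (simp add: a_0 AB)
  have tele: "(\<Sum>i<k. a i * a i) = A - a k" for k
    by (induction k) (simp_all add: a_0 a_Suc)
  show ?thesis
    unfolding pos_op_def
  proof (intro conjI allI)
    show "hermitian (A * B)" using A B AB by (intro hermitian_mult) (auto intro: positive_hermitian)
    fix x
    have sq: "rin (app (a i) x) (app (a i) x) = rin x (app (a i * a i) x)" for i
      using a_pos[of i] by (simp add: hermitian_rin positive_hermitian)
    have "(\<Sum>i<k. (norm (app (a i) x))\<^sup>2) \<le> rin x (app A x)" for k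
    proof -
      have "(\<Sum>i<k. (norm (app (a i) x))\<^sup>2) = rin x (app (\<Sum>i<k. a i * a i) x)"
        by (induction k) (simp_all add: rin_simps app_simps sq flip: rin_self)
      also have "\<dots> = rin x (app A x) - rin x (app (a k) x)"
        by (simp add: tele app_simps rin_simps)
      also have "\<dots> \<le> rin x (app A x)" using a_pos[of k] positiveD by auto
      finally show ?thesis .
    qed
    then have "summable (\<lambda>i. (norm (app (a i) x))\<^sup>2)"
      by (intro bounded_imp_summable[where B="rin x (app A x)"])
        (simp_all del: sum.lessThan_Suc flip: lessThan_Suc_atMost)
    then have "(\<lambda>i. (norm (app (a i) x))\<^sup>2) \<longlonglongrightarrow> 0" by (rule summable_LIMSEQ_zero)
    then have "(\<lambda>i. sqrt ((norm (app (a i) x))\<^sup>2)) \<longlonglongrightarrow> sqrt 0" by (rule tendsto_real_sqrt)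
    then have a_lim: "(\<lambda>i. app (a i) x) \<longlonglongrightarrow> 0" by (simp add: tendsto_norm_zero_iff)
    have "0 \<le> rin x (app ((A - a k) * B) x)" for k
    proof -
      have "(A - a k) * B = (\<Sum>i<k. a i * B * a i)"
        unfolding tele[symmetric] sum_distrib_right
        by (intro sum.cong refl) (metis comm mult.assoc)
      moreover have "pos_op (\<Sum>i<k. a i * B * a i)"
        using a_pos by (intro positive_sum positive_sandwich B) (auto intro: positive_hermitian)
      ultimately show ?thesis by (simp add: positiveD)
    qed
    moreover have "rin x (app ((A - a k) * B) x) = rin x (app (A * B) x) - rin (app (a k) x) (app B x)" for k
      using a_pos[of k] by (simp add: app_simps rin_simps hermitian_rin positive_hermitian)
    ultimately have nn: "0 \<le> rin x (app (A * B) x) - rin (app (a k) x) (app B x)" for k by simp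
    have "(\<lambda>k. rin x (app (A * B) x) - rin (app (a k) x) (app B x))
        \<longlonglongrightarrow> rin x (app (A * B) x) - rin 0 (app B x)"
      by (intro tendsto_intros a_lim)
    then show "0 \<le> rin x (app (A * B) x)"
      using nn by (auto simp: rin_simps intro: LIMSEQ_le_const)
  qed
qed

lemma positive_mult:
  assumes "pos_op A" "pos_op B" "A * B = B * A"
  shows "pos_op (A * B)"
proof (cases "norm A = 0")
  case False
  define c where "c = norm A"
  have c: "0 < c" using False by (simp add: c_def)
  let ?A = "(1 / c) *\<^sub>R A"
  have "norm ?A \<le> 1" using c by (simp add: c_def)
  then have "pos_op (1 *\<^sub>R 1 - ?A)"
    using assms(1) by (intro positive_minus_if_norm_le hermitian_scaleR positive_hermitian)
  then have "pos_op (?A * B)"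
    using assms c by (intro positive_mult_contraction) (auto intro: positive_scaleR)
  then have "pos_op (c *\<^sub>R (?A * B))" using c by (intro positive_scaleR) auto
  then show ?thesis using c by simp
qed simp

section \<open>Powers of pos_op contractions\<close>

definition pos_contraction :: "'a::complex_hilbert_space endo \<Rightarrow> bool" where
  "pos_contraction F \<longleftrightarrow> pos_op F \<and> pos_op (1 - F)"

lemma pos_contraction_norm: "pos_contraction F \<Longrightarrow> norm F \<le> 1"
  using norm_le_if_positive[of F 1] by (simp add: pos_contraction_def)

lemma pos_contractionI: "pos_op F \<Longrightarrow> norm F \<le> 1 \<Longrightarrow> pos_contraction F"
  using positive_minus_if_norm_le[of F 1] by (simp add: pos_contraction_def positive_hermitian)

lemma pos_contraction_one_minus: "pos_contraction F \<Longrightarrow> pos_contraction (1 - F)"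
  by (simp add: pos_contraction_def)

lemma pos_contraction_mult:
  assumes "pos_contraction F" "pos_contraction G" "F * G = G * F"
  shows "pos_contraction (F * G)"
  by (intro pos_contractionI positive_mult norm_mult_le_left)
     (use assms pos_contraction_norm in \<open>auto simp: pos_contraction_def\<close>)

lemma pos_contraction_power:
  assumes "pos_contraction F"
  shows "pos_contraction (F ^ n)"
proof (induction n)
  case (Suc n)
  then show ?case
    using assms pos_contraction_mult[of F "F ^ n"] by (simp add: power_commutes)
qed (simp add: pos_contraction_def)

text \<open>
  Since \<open>F ^ i * (1 - F)\<close> decreases with \<open>i\<close> and these operators sum to \<open>1 - F ^ (j + 1) \<le> 1\<close>,
  each of the first \<open>j + 1\<close> of them is at least the last, which is therefore at most \<open>1 / (j + 1)\<close>.
\<close>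

lemma norm_power_mult_one_minus:
  assumes "pos_contraction F"
  shows "norm (F ^ j * (1 - F)) \<le> 1 / real (j + 1)"
proof (rule norm_le_if_positive)
  have pF: "pos_op (F ^ k)" "pos_op (1 - F ^ k)" "pos_op (1 - F)" for k
    using pos_contraction_power[OF assms] assms by (auto simp: pos_contraction_def)
  have comm: "F * F ^ k = F ^ k * F" for k by (simp add: power_commutes)
  show pos: "pos_op (F ^ j * (1 - F))"
    by (intro positive_mult pF) (simp add: algebra_simps comm)
  have tele: "(\<Sum>i\<le>j. F ^ i * (1 - F)) = 1 - F ^ (j + 1)"
  proof (induction j)
    case (Suc j)
    have "F ^ Suc j * (1 - F) = F ^ (j + 1) - F ^ (Suc j + 1)"
      by (simp add: right_diff_distrib power_commutes mult.assoc)
    then show ?case by (simp only: sum.atMost_Suc Suc) simp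
  qed (simp add: algebra_simps)
  have "pos_op ((F ^ i - F ^ j) * (1 - F))" if "i \<le> j" for i
  proof -
    have "(F ^ i - F ^ j) * (1 - F) = F ^ i * ((1 - F ^ (j - i)) * (1 - F))"
      using that by (simp add: right_diff_distrib left_diff_distrib mult.assoc[symmetric] flip: power_add)
    moreover have "pos_op \<dots>"
    proof (intro positive_mult pF)
      show "(1 - F ^ (j - i)) * (1 - F) = (1 - F) * (1 - F ^ (j - i))"
        by (simp add: algebra_simps comm)
      have c1: "F ^ i * (1 - F) = (1 - F) * F ^ i" by (simp add: algebra_simps comm)
      have c2: "F ^ i * (1 - F ^ (j - i)) = (1 - F ^ (j - i)) * F ^ i"
        by (simp add: algebra_simps flip: power_add)
      show "F ^ i * ((1 - F ^ (j - i)) * (1 - F)) = (1 - F ^ (j - i)) * (1 - F) * F ^ i"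
        by (simp only: mult.assoc[symmetric] c2) (simp only: mult.assoc c1)
    qed
    ultimately show ?thesis by simp
  qed
  then have "pos_op (F ^ (j + 1) + (\<Sum>i\<le>j. (F ^ i - F ^ j) * (1 - F)))"
    using pF(1)[of "j + 1"] by (intro positive_add positive_sum) auto
  also have "F ^ (j + 1) + (\<Sum>i\<le>j. (F ^ i - F ^ j) * (1 - F)) = 1 - real (j + 1) *\<^sub>R (F ^ j * (1 - F))"
    using tele by (simp add: left_diff_distrib[of "F ^ _" "F ^ j"] sum_subtractf scaleR_conv_of_real
        sum_constant_scaleR)
  finally have "pos_op ((1 / real (j + 1)) *\<^sub>R (1 - real (j + 1) *\<^sub>R (F ^ j * (1 - F))))"
    by (rule positive_scaleR) simp
  then show "pos_op ((1 / real (j + 1)) *\<^sub>R 1 - F ^ j * (1 - F))"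
    by (simp add: scaleR_diff_right)
qed simp

lemma norm_power_mult_one_minus_sq:
  assumes "pos_contraction F"
  shows "norm (F ^ j * (1 - F) * (1 - F)) \<le> 4 / (real (j + 1))\<^sup>2"
proof -
  define i where "i = j div 2"
  have j: "j = j mod 2 + (i + i)" by (simp add: i_def) presburger
  have comm: "(1 - F) * F ^ k = F ^ k * (1 - F)" for k
    by (simp add: algebra_simps power_commutes)
  have "F ^ j * (1 - F) * (1 - F) = F ^ (j mod 2) * ((F ^ i * (1 - F)) * (F ^ i * (1 - F)))"
  proof -
    have "F ^ j = F ^ (j mod 2) * (F ^ i * F ^ i)" by (subst j) (simp only: power_add)
    moreover have "F ^ i * (1 - F) * (F ^ i * (1 - F)) = F ^ i * F ^ i * (1 - F) * (1 - F)"
    proof -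
      have "F ^ i * (1 - F) * (F ^ i * (1 - F)) = F ^ i * ((1 - F) * F ^ i) * (1 - F)"
        by (simp only: mult.assoc)
      also have "\<dots> = F ^ i * (F ^ i * (1 - F)) * (1 - F)" by (simp only: comm)
      finally show ?thesis by (simp only: mult.assoc)
    qed
    ultimately show ?thesis by (simp only: mult.assoc)
  qed
  also have "norm \<dots> \<le> (1 / real (i + 1)) * (1 / real (i + 1))"
    by (intro norm_mult_le_left norm_mult_le norm_power_endo_le pos_contraction_norm
        norm_power_mult_one_minus assms)
  also have "\<dots> \<le> (2 / real (j + 1)) * (2 / real (j + 1))"
  proof -
    have "real (j + 1) \<le> 2 * real (i + 1)" unfolding i_def by simp
    then have "1 / real (i + 1) \<le> 2 / real (j + 1)" by (simp add: field_simps)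
    then show ?thesis by (intro mult_mono) auto
  qed
  finally show ?thesis by (simp add: power2_eq_square)
qed

text \<open>
  With \<open>A = n (1 - F)\<close>, these bounds express that \<open>F ^ j\<close>, where \<open>j\<close> is comparable to \<open>n\<close>,
  regularises like the holomorphic semigroup \<open>e\<^sup>-\<^sup>s\<^sup>A\<close> with \<open>s\<close> of order one.
\<close>

lemma norm_generator_mult_power:
  assumes "pos_contraction F" and "n \<le> 2 * (j + 1)"
  shows "norm ((1 + real n *\<^sub>R (1 - F)) * F ^ j) \<le> 3"
    and "norm ((1 + real n *\<^sub>R (1 - F)) * (1 + real n *\<^sub>R (1 - F)) * F ^ j) \<le> 21"
proof -
  let ?D = "1 - F"
  have comm: "?D * F ^ k = F ^ k * ?D" for k
    by (simp add: algebra_simps power_commutes)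
  have comm2: "?D * ?D * F ^ k = F ^ k * ?D * ?D" for k
    by (simp only: mult.assoc comm) (simp only: comm flip: mult.assoc)
  have n0: "norm (F ^ j) \<le> 1"
    using assms(1) by (intro norm_power_endo_le pos_contraction_norm)
  have nj: "real n \<le> 2 * real (j + 1)" using assms(2) by linarith
  have n1: "norm (real n *\<^sub>R (F ^ j * ?D)) \<le> 2"
  proof -
    have "norm (real n *\<^sub>R (F ^ j * ?D)) \<le> real n * (1 / real (j + 1))"
      using mult_left_mono[OF norm_power_mult_one_minus[OF assms(1), of j], of "real n"] by simp
    also have "\<dots> \<le> 2" using nj by (simp add: field_simps)
    finally show ?thesis .
  qed
  have n2: "norm ((real n)\<^sup>2 *\<^sub>R (F ^ j * ?D * ?D)) \<le> 16"
  proof -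
    have "norm ((real n)\<^sup>2 *\<^sub>R (F ^ j * ?D * ?D)) = (real n)\<^sup>2 * norm (F ^ j * ?D * ?D)" by simp
    also have "\<dots> \<le> (2 * real (j + 1))\<^sup>2 * (4 / (real (j + 1))\<^sup>2)"
      by (intro mult_mono power_mono nj norm_power_mult_one_minus_sq assms) auto
    also have "\<dots> = 16" by (simp add: power_mult_distrib field_simps del: of_nat_Suc of_nat_add)
    finally show ?thesis .
  qed
  have "(1 + real n *\<^sub>R ?D) * F ^ j = F ^ j + real n *\<^sub>R (F ^ j * ?D)"
    using comm[of j] by (simp only: distrib_right mult_1_left mult_scaleR_left)
  also have "norm \<dots> \<le> 1 + 2" by (rule norm_triangle_mono[OF n0 n1])
  finally show "norm ((1 + real n *\<^sub>R ?D) * F ^ j) \<le> 3" by simp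
  have "(1 + real n *\<^sub>R ?D) * (1 + real n *\<^sub>R ?D) * F ^ j
      = F ^ j + 2 *\<^sub>R (real n *\<^sub>R (?D * F ^ j)) + (real n)\<^sup>2 *\<^sub>R (?D * ?D * F ^ j)"
  proof -
    have "(1 + N) * (1 + N) * P = P + 2 *\<^sub>R (N * P) + N * N * P" for N P :: "'a endo"
      by (simp add: distrib_right distrib_left scaleR_2 add.assoc)
    from this[of "real n *\<^sub>R ?D" "F ^ j"] show ?thesis
      by (simp add: power2_eq_square)
  qed
  also have "\<dots> = F ^ j + 2 *\<^sub>R (real n *\<^sub>R (F ^ j * ?D)) + (real n)\<^sup>2 *\<^sub>R (F ^ j * ?D * ?D)"
    by (simp only: comm comm2)
  also have "norm \<dots> \<le> 1 + 4 + 16"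
  proof (intro norm_triangle_mono n0 n2)
    show "norm (2 *\<^sub>R real n *\<^sub>R (F ^ j * (1 - F))) \<le> 4" using n1 by simp
  qed
  finally show "norm ((1 + real n *\<^sub>R ?D) * (1 + real n *\<^sub>R ?D) * F ^ j) \<le> 21" by simp
qed

section \<open>Powers are controlled by resolvents\<close>

text \<open>
  Let \<open>X = 1 + n (1 - F)\<close> and \<open>Y = 1 + n (1 - G)\<close> with inverses \<open>R\<close> and \<open>Q\<close>. One step of the
  interpolation \<open>F ^ (n - k) * G ^ k\<close> from \<open>F ^ n\<close> to \<open>G ^ n\<close> costs
  \<open>F ^ a * X * (R - Q) * Y * G ^ k / n\<close>, where \<open>a + k + 1 = n\<close>. The norm of this is of order
  \<open>n / ((a + 1) * (k + 1)) * norm (R - Q)\<close>, and the sum over \<open>k\<close> would lose a factor \<open>log n\<close>. The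
  remedy is a different path in each half. As long as \<open>k \<le> n / 2\<close>, the path
  \<open>X * F ^ (n - k) * G ^ k * Q\<close> has the steps \<open>X * X * F ^ a * (Q - R) * G ^ k / n\<close>, in which the high power
  of \<open>F\<close> absorbs both large factors; and since \<open>X * Q = 1 + X * (Q - R)\<close>, it deviates from the
  original path by a multiple of \<open>Q - R\<close> only. The steps add up to \<open>21\<close> and the deviations at
  the two ends to \<open>3 + 3\<close>.
\<close>

lemma norm_interpolation_first_half:
  fixes F G R Q X Y :: "'a::complex_hilbert_space endo"
  assumes F: "pos_contraction F" and G: "pos_contraction G" and n: "0 < n" and p: "2 * p \<le> n + 1"
    and X: "X = 1 + real n *\<^sub>R (1 - F)" and Y: "Y = 1 + real n *\<^sub>R (1 - G)"
    and R: "X * R = 1" and Q: "Q * Y = 1" "Y * Q = 1"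
  shows "norm (F ^ n - F ^ (n - p) * G ^ p) \<le> 27 * norm (R - Q)"
proof -
  define \<delta> where "\<delta> = norm (R - Q)"
  have XF: "X * F ^ k = F ^ k * X" for k by (simp add: X algebra_simps power_commutes)
  have YG: "Y * G ^ k = G ^ k * Y" for k by (simp add: Y algebra_simps power_commutes)
  have QG: "G ^ k * Q = Q * G ^ k" for k
  proof -
    have "G ^ k * Q = Q * (Y * G ^ k) * Q" by (simp add: Q flip: mult.assoc)
    also have "\<dots> = Q * G ^ k * (Y * Q)" by (simp only: YG mult.assoc)
    finally show ?thesis by (simp add: Q)
  qed
  have XQ: "X * Q = 1 + X * (Q - R)" by (simp add: right_diff_distrib R)
  have XYQ: "(G - F) * Q = (1 / real n) *\<^sub>R (X * (Q - R))"
  proof -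
    have "G - F = (1 / real n) *\<^sub>R (X - Y)" using n by (simp add: X Y algebra_simps)
    then show ?thesis by (simp add: left_diff_distrib right_diff_distrib R Q)
  qed
  define f where "f k = X * F ^ (n - k) * G ^ k * Q" for k
  have step: "norm (f (Suc k) - f k) \<le> 21 * \<delta> / real n" if "k \<in> {0..<p}" for k
  proof -
    define a where "a = n - Suc k"
    have a: "n - k = Suc a" "n - Suc k = a" using that p by (auto simp: a_def)
    have "f (Suc k) - f k = X * F ^ a * (G - F) * (G ^ k * Q)"
    proof -
      have "f (Suc k) = X * F ^ a * (G * G ^ k) * Q" by (simp add: f_def a)
      moreover have "f k = X * (F ^ a * F) * G ^ k * Q"
        by (simp add: f_def a power_Suc2 del: power_Suc)
      ultimately show ?thesis by (simp only: left_diff_distrib right_diff_distrib mult.assoc)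
    qed
    also have "\<dots> = X * F ^ a * ((G - F) * Q) * G ^ k" by (simp add: QG mult.assoc)
    also have "\<dots> = (1 / real n) *\<^sub>R (X * X * F ^ a * (Q - R) * G ^ k)"
    proof -
      have "X * F ^ a * (X * (Q - R)) * G ^ k = X * (F ^ a * X) * (Q - R) * G ^ k"
        by (simp only: mult.assoc)
      also have "\<dots> = X * X * F ^ a * (Q - R) * G ^ k" by (simp only: XF[symmetric] mult.assoc)
      finally show ?thesis by (simp only: XYQ mult_scaleR_left mult_scaleR_right)
    qed
    also have "norm \<dots> \<le> (1 / real n) * (21 * \<delta>)"
    proof -
      have "norm (X * X * F ^ a * (Q - R) * G ^ k) \<le> 21 * \<delta>"
        unfolding X
        by (intro norm_mult_le_right norm_mult_le norm_generator_mult_power F norm_power_endo_le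
            pos_contraction_norm G) (use that p in \<open>auto simp: a_def \<delta>_def norm_minus_commute\<close>)
      then show ?thesis using n by (simp add: divide_right_mono)
    qed
    finally show ?thesis by simp
  qed
  have "norm (f p - f 0) = norm (\<Sum>k=0..<p. f (Suc k) - f k)" by (simp add: sum_Suc_diff')
  also have "\<dots> \<le> (\<Sum>k=0..<p. 21 * \<delta> / real n)" by (rule sum_norm_le[OF step])
  also have "\<dots> = 21 * \<delta> * (real p / real n)" by simp
  also have "\<dots> \<le> 21 * \<delta> * 1" using p n by (intro mult_left_mono) (auto simp: \<delta>_def)
  finally have fp: "norm (f p - f 0) \<le> 21 * \<delta>" by simp
  have f: "f k = F ^ (n - k) * G ^ k + X * F ^ (n - k) * (Q - R) * G ^ k" for k
  proof -
    have "f k = X * F ^ (n - k) * (G ^ k * Q)" by (simp only: f_def mult.assoc)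
    also have "\<dots> = F ^ (n - k) * X * (Q * G ^ k)" by (simp only: XF QG)
    also have "\<dots> = F ^ (n - k) * (X * Q) * G ^ k" by (simp only: mult.assoc)
    also have "\<dots> = F ^ (n - k) * G ^ k + F ^ (n - k) * X * (Q - R) * G ^ k"
      by (simp only: XQ distrib_left distrib_right mult_1_right mult.assoc)
    finally show ?thesis by (simp only: XF)
  qed
  have corr: "norm (X * F ^ (n - k) * (Q - R) * G ^ k) \<le> 3 * \<delta>" if "k \<le> p" for k
    unfolding X
    by (intro norm_mult_le_right norm_mult_le norm_generator_mult_power F norm_power_endo_le
        pos_contraction_norm G) (use that p in \<open>auto simp: \<delta>_def norm_minus_commute\<close>)
  have "F ^ n - F ^ (n - p) * G ^ p
      = (f 0 - f p) - (X * F ^ (n - 0) * (Q - R) * G ^ 0 - X * F ^ (n - p) * (Q - R) * G ^ p)"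
    by (simp add: f)
  also have "norm \<dots> \<le> 21 * \<delta> + (3 * \<delta> + 3 * \<delta>)"
  proof -
    have "norm (u - (v - w)) \<le> norm u + (norm v + norm w)" for u v w :: "'a endo"
      by (meson add_left_mono norm_triangle_ineq4 order_trans)
    then show ?thesis
      by (rule order_trans) (intro add_mono corr, use fp in \<open>auto simp: norm_minus_commute\<close>)
  qed
  finally show ?thesis by (simp add: \<delta>_def)
qed


lemma norm_adjoint_le:
  assumes "\<And>x y. rin (app A x) y = rin x (app B y)"
  shows "norm A \<le> norm B"
proof (rule norm_endo_bound)
  fix x
  have "(norm (app A x))\<^sup>2 = rin x (app B (app A x))"
    by (simp add: assms flip: rin_self)
  also have "\<dots> \<le> norm x * (norm B * norm (app A x))"
    using rin_le_norm[of x "app B (app A x)"] mult_left_mono[OF norm_app[of B "app A x"], of "norm x"]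
    by simp
  finally have "norm (app A x) * norm (app A x) \<le> (norm B * norm x) * norm (app A x)"
    by (simp add: power2_eq_square mult_ac)
  then show "norm (app A x) \<le> norm B * norm x"
    by (cases "app A x = 0") simp_all
qed simp

text \<open>The second half is the first one with \<open>F\<close> and \<open>G\<close> exchanged, up to taking adjoints.\<close>

theorem norm_power_diff_le_resolvent_diff:
  fixes F G R Q :: "'a::complex_hilbert_space endo"
  assumes F: "pos_contraction F" and G: "pos_contraction G" and n: "0 < n"
    and R: "R * (1 + real n *\<^sub>R (1 - F)) = 1" "(1 + real n *\<^sub>R (1 - F)) * R = 1"
    and Q: "Q * (1 + real n *\<^sub>R (1 - G)) = 1" "(1 + real n *\<^sub>R (1 - G)) * Q = 1"
  shows "norm (F ^ n - G ^ n) \<le> 54 * norm (R - Q)"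
proof -
  define p where "p = n div 2"
  have p: "2 * p \<le> n + 1" "2 * (n - p) \<le> n + 1" "n - (n - p) = p" unfolding p_def by presburger+
  have 1: "norm (F ^ n - F ^ (n - p) * G ^ p) \<le> 27 * norm (R - Q)"
    by (rule norm_interpolation_first_half[OF F G n p(1) refl refl]) (use R Q in auto)
  have "norm (F ^ (n - p) * G ^ p - G ^ n) \<le> norm (G ^ p * F ^ (n - p) - G ^ n)"
  proof (rule norm_adjoint_le)
    have h: "hermitian (F ^ k)" "hermitian (G ^ k)" for k
      using F G positive_hermitian by (auto intro!: hermitian_power simp: pos_contraction_def)
    show "rin (app (F ^ (n - p) * G ^ p - G ^ n) x) y = rin x (app (G ^ p * F ^ (n - p) - G ^ n) y)" for x y
      using h by (simp add: app_simps rin_simps hermitian_rin)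
  qed
  also have "\<dots> \<le> 27 * norm (Q - R)"
    using norm_interpolation_first_half[OF G F n p(2) refl refl, of Q R] R Q p(3)
    by (simp add: norm_minus_commute)
  finally have 2: "norm (F ^ (n - p) * G ^ p - G ^ n) \<le> 27 * norm (R - Q)"
    by (simp add: norm_minus_commute)
  have "F ^ n - G ^ n = (F ^ n - F ^ (n - p) * G ^ p) + (F ^ (n - p) * G ^ p - G ^ n)" by simp
  also have "norm \<dots> \<le> 27 * norm (R - Q) + 27 * norm (R - Q)" by (rule norm_triangle_mono[OF 1 2])
  finally show ?thesis by simp
qed

section \<open>Resolvents of a nonnegative self-adjoint operator\<close>

lemma exists_orthogonal_vector:
  fixes W :: "'a::complex_hilbert_space set"
  assumes W: "closed W" "0 \<in> W" "\<And>x y. x \<in> W \<Longrightarrow> y \<in> W \<Longrightarrow> x + y \<in> W"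
    "\<And>c x. x \<in> W \<Longrightarrow> c *\<^sub>C x \<in> W" and y: "y \<notin> W"
  shows "\<exists>v. v \<noteq> 0 \<and> (\<forall>w\<in>W. cinner v w = 0)"
proof -
  have scaleR_W: "r *\<^sub>R x \<in> W" if "x \<in> W" for r x
    using W(4)[OF that, of "complex_of_real r"] by (simp add: scaleC_of_real)
  define d where "d = (INF w\<in>W. (norm (y - w))\<^sup>2)"
  have bdd: "bdd_below ((\<lambda>w. (norm (y - w))\<^sup>2) ` W)" by (rule bdd_belowI2[where m=0]) simp
  have d_le: "d \<le> (norm (y - w))\<^sup>2" if "w \<in> W" for w
    unfolding d_def using bdd that by (rule cINF_lower)
  have "\<exists>w\<in>W. (norm (y - w))\<^sup>2 < d + 1 / real (Suc n)" for n
    using cINF_less_iff[OF _ bdd, of "d + 1 / real (Suc n)"] W(2) by (auto simp: d_def)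
  then obtain w where w: "\<And>n. w n \<in> W" "\<And>n. (norm (y - w n))\<^sup>2 < d + 1 / real (Suc n)"
    by metis
  \<comment> \<open>The parallelogram law, together with the fact that midpoints stay in \<^term>\<open>W\<close>, makes a
    minimising sequence a Cauchy sequence.\<close>
  have close: "(norm (w m - w n))\<^sup>2 \<le> 2 / real (Suc m) + 2 / real (Suc n)" for m n
  proof -
    have "(norm (w m - w n))\<^sup>2 = 2 * (norm (y - w m))\<^sup>2 + 2 * (norm (y - w n))\<^sup>2
        - 4 * (norm (y - (1/2) *\<^sub>R (w m + w n)))\<^sup>2"
      by (simp flip: rin_self add: rin_simps algebra_simps)
    moreover have "d \<le> (norm (y - (1/2) *\<^sub>R (w m + w n)))\<^sup>2"
      by (intro d_le scaleR_W W w)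
    ultimately show ?thesis using w(2)[of m] w(2)[of n] by simp
  qed
  have "Cauchy w"
  proof (rule CauchyI)
    fix e :: real assume "0 < e"
    obtain N where N: "4 / e\<^sup>2 < real N" using reals_Archimedean2 by blast
    have "0 < 4 / e\<^sup>2" using \<open>0 < e\<close> by simp
    then have "0 < real N" using N by linarith
    have "norm (w m - w n) < e" if "m \<ge> N" "n \<ge> N" for m n
    proof -
      have "(norm (w m - w n))\<^sup>2 \<le> 2 / real (Suc m) + 2 / real (Suc n)" by (rule close)
      also have "\<dots> \<le> 2 / real N + 2 / real N"
        using that \<open>0 < real N\<close> by (intro add_mono divide_left_mono) auto
      also have "\<dots> < e\<^sup>2" using N \<open>0 < real N\<close> \<open>0 < e\<close> by (simp add: field_simps)
      finally show ?thesis using \<open>0 < e\<close> by (simp add: power_less_imp_less_base)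
    qed
    then show "\<exists>M. \<forall>m\<ge>M. \<forall>n\<ge>M. norm (w m - w n) < e" by blast
  qed
  then obtain w0 where w0: "w \<longlonglongrightarrow> w0" by (auto simp: Cauchy_convergent_iff convergent_def)
  have w0_W: "w0 \<in> W" using closed_sequentially[OF W(1) w(1) w0] .
  have "(\<lambda>n. (norm (y - w n))\<^sup>2) \<longlonglongrightarrow> (norm (y - w0))\<^sup>2" by (intro tendsto_intros w0)
  moreover have "(\<lambda>n. d + 1 / real (Suc n)) \<longlonglongrightarrow> d + 0"
    by (intro tendsto_intros LIMSEQ_Suc[OF lim_1_over_n])
  ultimately have min: "(norm (y - w0))\<^sup>2 \<le> d"
    using w(2) by (auto intro: LIMSEQ_le less_imp_le)
  define v where "v = y - w0"
  have rin0: "rin v x = 0" if "x \<in> W" for x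
  proof -
    have "(rin v x)\<^sup>2 \<le> 0 * rin x x"
    proof (rule discriminant_le)
      fix t
      have "(norm v)\<^sup>2 \<le> (norm (y - (w0 - t *\<^sub>R x)))\<^sup>2"
      proof -
        have "w0 - t *\<^sub>R x \<in> W" using W(3)[OF w0_W scaleR_W[OF that], of "- t"] by simp
        then show ?thesis using order_trans[OF min d_le] by (simp only: v_def)
      qed
      also have "y - (w0 - t *\<^sub>R x) = v + t *\<^sub>R x" by (simp add: v_def)
      also have "(norm (v + t *\<^sub>R x))\<^sup>2 = (norm v)\<^sup>2 + 2 * t * rin v x + t\<^sup>2 * rin x x"
        by (simp flip: rin_self add: rin_simps rin_commute[of x v] power2_eq_square[of t] distrib_left mult.assoc)
      finally show "0 \<le> 0 + 2 * t * rin v x + t\<^sup>2 * rin x x" by simp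
    qed (simp add: rin_self)
    then show ?thesis by simp
  qed
  have "cinner v x = 0" if "x \<in> W" for x
    using rin0[OF that] rin0[OF W(4)[OF that, of \<i>]] by (simp add: complex_eq_iff Im_cinner) (simp add: rin_def)
  moreover have "v \<noteq> 0" using y w0_W by (auto simp: v_def)
  ultimately show ?thesis by blast
qed

locale nonneg_self_adjoint =
  fixes D :: "'a::complex_hilbert_space set" and H :: "'a \<Rightarrow> 'a"
  assumes self_adj: "self_adjoint D H" and nonneg: "nonneg_operator D H"
begin

lemma zero_D: "0 \<in> D"
  and add_D: "x \<in> D \<Longrightarrow> y \<in> D \<Longrightarrow> x + y \<in> D"
  and H_add: "x \<in> D \<Longrightarrow> y \<in> D \<Longrightarrow> H (x + y) = H x + H y"
  and scaleC_D: "x \<in> D \<Longrightarrow> c *\<^sub>C x \<in> D"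
  and H_scaleC: "x \<in> D \<Longrightarrow> H (c *\<^sub>C x) = c *\<^sub>C H x"
  and dense_D: "closure D = UNIV"
  using self_adj by (auto simp: self_adjoint_def linear_operator_def)

lemma scaleR_D: "x \<in> D \<Longrightarrow> r *\<^sub>R x \<in> D"
  and H_scaleR: "x \<in> D \<Longrightarrow> H (r *\<^sub>R x) = r *\<^sub>R H x"
  using scaleC_D[of x "complex_of_real r"] H_scaleC[of x "complex_of_real r"]
  by (simp_all add: scaleC_of_real)

lemma diff_D: "x \<in> D \<Longrightarrow> y \<in> D \<Longrightarrow> x - y \<in> D"
  and H_diff: "x \<in> D \<Longrightarrow> y \<in> D \<Longrightarrow> H (x - y) = H x - H y"
  using add_D[of x "- y"] H_add[of x "- y"] scaleR_D[of y "-1"] H_scaleR[of y "-1"] by auto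

lemma H_symmetric: "x \<in> D \<Longrightarrow> y \<in> D \<Longrightarrow> cinner x (H y) = cinner (H x) y"
proof -
  assume x: "x \<in> D" and y: "y \<in> D"
  have "(x, H x) \<in> adjoint_graph D H"
    using self_adj x by (auto simp: self_adjoint_def operator_graph_def)
  then show ?thesis using y by (simp add: adjoint_graph_def)
qed

lemma H_maximal:
  assumes "\<And>x. x \<in> D \<Longrightarrow> cinner y (H x) = cinner z x"
  shows "y \<in> D \<and> z = H y"
proof -
  have "(y, z) \<in> operator_graph D H"
    using self_adj assms by (auto simp: self_adjoint_def adjoint_graph_def)
  then show ?thesis by (auto simp: operator_graph_def)
qed

lemma H_nonneg: "x \<in> D \<Longrightarrow> 0 \<le> rin x (H x)"
  using nonneg by (auto simp: nonneg_operator_def rin_def complex_nonneg_Reals_iff)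

lemma H_closed:
  assumes "\<And>n. x n \<in> D" "x \<longlonglongrightarrow> a" "(\<lambda>n. H (x n)) \<longlonglongrightarrow> b"
  shows "a \<in> D \<and> b = H a"
proof (rule H_maximal)
  fix z assume "z \<in> D"
  have "(\<lambda>n. cinner (x n) (H z)) \<longlonglongrightarrow> cinner a (H z)"
    "(\<lambda>n. cinner (H (x n)) z) \<longlonglongrightarrow> cinner b z"
    by (intro cinner.tendsto assms tendsto_const)+
  then show "cinner a (H z) = cinner b z"
    using H_symmetric[OF assms(1) \<open>z \<in> D\<close>] LIMSEQ_unique by auto
qed

lemma norm_le_one_plus_H:
  assumes "x \<in> D" "0 \<le> h"
  shows "norm x \<le> norm (x + h *\<^sub>R H x)"
proof -
  have "norm x * norm x \<le> rin x (x + h *\<^sub>R H x)"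
    using H_nonneg[OF assms(1)] assms(2) by (simp add: rin_simps rin_self power2_eq_square)
  also have "\<dots> \<le> norm x * norm (x + h *\<^sub>R H x)" using rin_le_norm[of x "x + h *\<^sub>R H x"] by simp
  finally show ?thesis by (cases "x = 0") auto
qed

text \<open>
  The range of \<open>1 + h H\<close> is closed because \<open>H\<close> is closed and \<open>1 + h H\<close> is bounded below. A vector
  \<open>v\<close> orthogonal to it lies in the domain of the adjoint with \<open>H v = - v / h\<close>, so that \<open>v = 0\<close>
  since \<open>H\<close> is nonnegative.
\<close>

lemma one_plus_H_surj:
  assumes h: "0 < h"
  shows "\<exists>x\<in>D. x + h *\<^sub>R H x = y"
proof (rule ccontr)
  define W where "W = (\<lambda>x. x + h *\<^sub>R H x) ` D"
  assume "\<not> (\<exists>x\<in>D. x + h *\<^sub>R H x = y)"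
  then have y: "y \<notin> W" by (auto simp: W_def)
  have closed: "closed W"
    unfolding closed_sequential_limits
  proof (intro allI impI, elim conjE)
    fix s l assume s: "\<forall>n. s n \<in> W" "s \<longlonglongrightarrow> l"
    then have "\<forall>n. \<exists>a. a \<in> D \<and> s n = a + h *\<^sub>R H a" by (auto simp: W_def image_iff)
    then obtain x where x: "\<And>n. x n \<in> D" "\<And>n. s n = x n + h *\<^sub>R H (x n)"
      using choice[of "\<lambda>n a. a \<in> D \<and> s n = a + h *\<^sub>R H a"] by blast
    have "norm (x m - x n) \<le> norm (s m - s n)" for m n
      using norm_le_one_plus_H[OF diff_D[OF x(1) x(1)], of h m n] h
      by (simp add: x H_diff scaleR_diff_right algebra_simps)
    note le = this
    have "Cauchy x"
    proof (rule CauchyI)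
      fix e :: real assume "0 < e"
      then obtain N where N: "\<And>m n. m \<ge> N \<Longrightarrow> n \<ge> N \<Longrightarrow> norm (s m - s n) < e"
        using CauchyD[OF LIMSEQ_imp_Cauchy[OF s(2)]] by meson
      show "\<exists>M. \<forall>m\<ge>M. \<forall>n\<ge>M. norm (x m - x n) < e"
        by (intro exI[of _ N] allI impI order_le_less_trans[OF le N])
    qed
    then obtain a where a: "x \<longlonglongrightarrow> a" by (auto simp: Cauchy_convergent_iff convergent_def)
    have "(\<lambda>n. (1 / h) *\<^sub>R (s n - x n)) \<longlonglongrightarrow> (1 / h) *\<^sub>R (l - a)" by (intro tendsto_intros s a)
    then have "a \<in> D \<and> (1 / h) *\<^sub>R (l - a) = H a"
      using h by (intro H_closed[of x] x a) (simp add: x)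
    then have aD: "a \<in> D" and "h *\<^sub>R H a = h *\<^sub>R (1 / h) *\<^sub>R (l - a)" by simp_all
    then have "l = a + h *\<^sub>R H a" using h by simp
    then show "l \<in> W" using aD by (simp add: W_def)
  qed
  have zero: "0 \<in> W"
    unfolding W_def using zero_D H_scaleR[OF zero_D, of 0] by (intro image_eqI[where x=0]) simp_all
  have add: "u + w \<in> W" if uw: "u \<in> W" "w \<in> W" for u w
  proof -
    obtain a b where "a \<in> D" "b \<in> D" "u = a + h *\<^sub>R H a" "w = b + h *\<^sub>R H b"
      using uw by (auto simp: W_def)
    then show ?thesis
      unfolding W_def by (intro image_eqI[where x="a + b"]) (simp_all add: H_add scaleR_add_right add_D)
  qed
  have scale: "c *\<^sub>C u \<in> W" if uW: "u \<in> W" for c u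
  proof -
    obtain a where a: "a \<in> D" "u = a + h *\<^sub>R H a" using uW by (auto simp: W_def)
    have "c *\<^sub>C u = c *\<^sub>C a + h *\<^sub>R H (c *\<^sub>C a)"
      by (simp add: a H_scaleC scaleC_add_right scaleC_scaleC mult.commute flip: scaleC_of_real)
    then show ?thesis using a by (auto simp: W_def intro!: scaleC_D)
  qed
  obtain v where v: "v \<noteq> 0" "\<And>w. w \<in> W \<Longrightarrow> cinner v w = 0"
    using exists_orthogonal_vector[OF closed zero add scale y] by auto
  have "v \<in> D \<and> (- 1 / h) *\<^sub>R v = H v"
  proof (rule H_maximal)
    fix x assume "x \<in> D"
    then have "cinner v (x + h *\<^sub>R H x) = 0" by (intro v) (auto simp: W_def)
    then have "cinner v x = - (h *\<^sub>R cinner v (H x))"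
      by (simp add: cinner_add_right cinner_scaleR_right eq_neg_iff_add_eq_0)
    then show "cinner v (H x) = cinner ((- 1 / h) *\<^sub>R v) x"
      using h by (simp add: cinner_scaleR_left cinner_minus_left)
  qed
  then have "0 \<le> rin v ((- 1 / h) *\<^sub>R v)" using H_nonneg[of v] by simp
  then show False using v(1) h by (simp add: rin_simps rin_self divide_le_0_iff)
qed

text \<open>
  The resolvent \<open>(1 + h H)\<^sup>-\<^sup>1\<close>. The inverse of \<open>1 + 0 H\<close> is defined on \<open>D\<close> only; the value
  \<open>J 0 = 1\<close> is its continuous extension and makes most of the identities below hold for \<open>h = 0\<close> too.
\<close>

definition J :: "real \<Rightarrow> 'a endo" where
  "J h = (if 0 < h then endo (Blinfun (\<lambda>y. SOME x. x \<in> D \<and> x + h *\<^sub>R H x = y)) else 1)"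

lemma
  assumes h: "0 < h"
  shows J_in_D: "app (J h) y \<in> D"
    and J_right: "app (J h) y + h *\<^sub>R H (app (J h) y) = y"
    and J_left: "x \<in> D \<Longrightarrow> app (J h) (x + h *\<^sub>R H x) = x"
    and norm_J_pos: "norm (J h) \<le> 1"
proof -
  define f where "f y = (SOME x. x \<in> D \<and> x + h *\<^sub>R H x = y)" for y
  have f: "f y \<in> D" "f y + h *\<^sub>R H (f y) = y" for y
    using someI_ex[of "\<lambda>x. x \<in> D \<and> x + h *\<^sub>R H x = y"] one_plus_H_surj[OF h, of y]
    by (auto simp: f_def)
  have uniq: "a = b" if "a \<in> D" "b \<in> D" "a + h *\<^sub>R H a = b + h *\<^sub>R H b" for a b
  proof -
    have "(a - b) + h *\<^sub>R H (a - b) = 0" using that by (simp add: H_diff scaleR_diff_right algebra_simps)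
    then show ?thesis using norm_le_one_plus_H[of "a - b" h] diff_D that h by simp
  qed
  have norm_f: "norm (f y) \<le> 1 * norm y" for y
    using norm_le_one_plus_H[OF f(1)[of y], of h] h by (simp add: f(2))
  have "bounded_linear f"
  proof (rule bounded_linear_intro)
    show "f (x + y) = f x + f y" for x y
    proof (rule uniq)
      have "f x + f y + h *\<^sub>R H (f x + f y) = (f x + h *\<^sub>R H (f x)) + (f y + h *\<^sub>R H (f y))"
        by (simp add: f(1) H_add scaleR_add_right)
      then show "f (x + y) + h *\<^sub>R H (f (x + y)) = f x + f y + h *\<^sub>R H (f x + f y)"
        by (simp only: f(2))
    qed (simp_all add: f add_D)
    show "f (r *\<^sub>R x) = r *\<^sub>R f x" for r x
    proof (rule uniq)
      have "r *\<^sub>R f x + h *\<^sub>R H (r *\<^sub>R f x) = r *\<^sub>R (f x + h *\<^sub>R H (f x))"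
        by (simp add: f(1) H_scaleR scaleR_add_right mult.commute)
      then show "f (r *\<^sub>R x) + h *\<^sub>R H (f (r *\<^sub>R x)) = r *\<^sub>R f x + h *\<^sub>R H (r *\<^sub>R f x)"
        by (simp add: f(2))
    qed (simp_all add: f scaleR_D)
    show "norm (f x) \<le> norm x * 1" for x using norm_f[of x] by simp
  qed
  then have app_J: "app (J h) = f"
    using h by (simp add: J_def app_def endo_inverse bounded_linear_Blinfun_apply f_def[abs_def])
  show "app (J h) y \<in> D" "app (J h) y + h *\<^sub>R H (app (J h) y) = y" by (simp_all add: app_J f)
  show "app (J h) (x + h *\<^sub>R H x) = x" if "x \<in> D"
    unfolding app_J by (rule uniq) (simp_all add: f that)
  show "norm (J h) \<le> 1" by (rule norm_endo_bound) (use norm_f in \<open>simp_all add: app_J\<close>)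
qed

lemma J_0 [simp]: "J 0 = 1"
  by (simp add: J_def)

lemma J_right_eq:
  assumes "0 < h"
  shows "h *\<^sub>R H (app (J h) y) = y - app (J h) y"
  using J_right[OF assms, of y] by (simp add: algebra_simps)

lemma J_pos_contraction: "pos_contraction (J h)"
proof (cases "0 < h")
  case h: True
  let ?f = "app (J h)"
  have eq: "cinner (?f x) y = cinner (?f x) (?f y) + h *\<^sub>R cinner (H (?f x)) (?f y)" for x y
    by (subst J_right[OF h, of y, symmetric])
      (simp add: cinner_add_right cinner_scaleR_right H_symmetric J_in_D[OF h])
  have eq': "cinner x (?f y) = cinner (?f x) (?f y) + h *\<^sub>R cinner (H (?f x)) (?f y)" for x y
    by (subst J_right[OF h, of x, symmetric])
      (simp add: cinner_add_left cinner_scaleR_left)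
  have "pos_op (J h)"
    unfolding pos_op_def hermitian_def
  proof (intro conjI allI)
    fix x
    have "rin x (?f x) = rin (?f x) (?f x) + h * rin (?f x) (H (?f x))"
      using eq'[of x x] by (simp add: rin_def H_symmetric J_in_D[OF h])
    then show "0 \<le> rin x (?f x)"
      using h H_nonneg[OF J_in_D[OF h]] by (simp add: rin_self)
  qed (rule trans[OF eq eq'[symmetric]])
  then show ?thesis by (intro pos_contractionI norm_J_pos h)
qed (simp add: J_def pos_contraction_def)

lemma norm_J: "norm (J h) \<le> 1"
  by (intro pos_contraction_norm J_pos_contraction)

lemma one_minus_J:
  assumes "x \<in> D" "0 \<le> h"
  shows "x - app (J h) x = h *\<^sub>R app (J h) (H x)"
proof (cases "h = 0")
  case False
  then have "app (J h) (x + h *\<^sub>R H x) = x" using assms by (intro J_left) auto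
  then show ?thesis by (simp add: app_simps algebra_simps)
qed simp

lemma H_J:
  assumes "x \<in> D" "0 \<le> h"
  shows "H (app (J h) x) = app (J h) (H x)"
proof (cases "h = 0")
  case False
  then have "h *\<^sub>R H (app (J h) x) = h *\<^sub>R app (J h) (H x)"
    using assms one_minus_J[OF assms] J_right_eq[of h x] by simp
  then show ?thesis using False by simp
qed simp

text \<open>The resolvent identity; formally both sides are \<open>a b H J\<^sub>a J\<^sub>b\<close>.\<close>

lemma J_resolvent:
  assumes "0 \<le> a" "0 \<le> b"
  shows "a *\<^sub>R (J a * (1 - J b)) = b *\<^sub>R ((1 - J a) * J b)"
proof (cases "a = 0 \<or> b = 0")
  case False
  then have ab: "0 < a" "0 < b" using assms by auto
  show ?thesis
  proof (rule endo_eqI)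
    fix x
    let ?y = "app (J b) x"
    have "app (a *\<^sub>R (J a * (1 - J b))) x = (a * b) *\<^sub>R app (J a) (H ?y)"
    proof -
      have "app (J a) (x - ?y) = b *\<^sub>R app (J a) (H ?y)"
        by (simp only: J_right_eq[OF ab(2), symmetric] app.scaleR_right)
      then show ?thesis by (simp add: app.scaleR_left app.diff_left)
    qed
    also have "\<dots> = app (b *\<^sub>R ((1 - J a) * J b)) x"
      using one_minus_J[OF J_in_D[OF ab(2)], of a x] ab by (simp add: app_simps mult.commute)
    finally show "app (a *\<^sub>R (J a * (1 - J b))) x = app (b *\<^sub>R ((1 - J a) * J b)) x" .
  qed
qed auto

lemma J_commute: "0 \<le> a \<Longrightarrow> 0 \<le> b \<Longrightarrow> J a * J b = J b * J a"
proof (cases "a = 0 \<or> b = 0")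
  case False
  assume "0 \<le> a" "0 \<le> b"
  then have ab: "0 < a" "0 < b" using False by auto
  show ?thesis
  proof (rule endo_eqI)
    fix x
    let ?u = "app (J b) (app (J a) x)"
    have D: "app (J a) x \<in> D" by (rule J_in_D[OF ab(1)])
    have "?u + a *\<^sub>R H ?u = app (J b) x"
    proof -
      have "?u + a *\<^sub>R H ?u = app (J b) (app (J a) x + a *\<^sub>R H (app (J a) x))"
        using H_J[OF D, of b] ab by (simp add: app.scaleR_right app.add_right)
      then show ?thesis by (simp only: J_right[OF ab(1)])
    qed
    then have "app (J a) (app (J b) x) = ?u"
      using J_left[OF ab(1) J_in_D[OF ab(2)], of "app (J a) x"] by simp
    then show "app (J a * J b) x = app (J b * J a) x" by simp
  qed
qed auto

end

text \<open>Bounded positive operators are the special case of full domain.\<close>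

lemma full_domain_nonneg_self_adjoint:
  assumes "pos_op A"
  shows "nonneg_self_adjoint UNIV (app A)"
proof
  note h = hermitianD[OF positive_hermitian[OF assms]]
  show "self_adjoint UNIV (app A)"
    unfolding self_adjoint_def
  proof (intro conjI)
    show "linear_operator UNIV (app A)"
      by (simp add: linear_operator_def app_simps hermitian_scaleC positive_hermitian assms)
    show "adjoint_graph UNIV (app A) = operator_graph UNIV (app A)"
    proof -
      have "z = app A y" if "\<forall>x. cinner y (app A x) = cinner z x" for y z
      proof -
        have "cinner (z - app A y) (z - app A y) = 0"
          using that by (simp add: cinner_diff_left h)
        then show ?thesis by (simp add: cinner_self)
      qed
      then show ?thesis by (auto simp: adjoint_graph_def operator_graph_def h)
    qed
  qed simp
  show "nonneg_operator UNIV (app A)"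
    unfolding nonneg_operator_def
  proof (intro ballI)
    fix x
    have "cnj (cinner x (app A x)) = cinner x (app A x)"
      by (subst cinner_commute[symmetric]) (rule h)
    then have "Im (cinner x (app A x)) = 0" by (simp add: complex_eq_iff)
    then show "cinner x (app A x) \<in> \<real>\<^sub>\<ge>\<^sub>0"
      using positiveD[OF assms, of x] by (simp add: complex_nonneg_Reals_iff rin_def)
  qed
qed

lemma resolvent_exists:
  assumes "pos_op A"
  obtains R where "pos_contraction R" "R * (1 + A) = 1" "(1 + A) * R = 1"
proof -
  interpret A: nonneg_self_adjoint UNIV "app A" by (rule full_domain_nonneg_self_adjoint[OF assms])
  have "A.J 1 * (1 + A) = 1"
    by (rule endo_eqI) (use A.J_left[of 1] in \<open>simp add: app_simps\<close>)
  moreover have "(1 + A) * A.J 1 = 1"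
    by (rule endo_eqI) (use A.J_right[of 1] in \<open>simp add: app_simps\<close>)
  ultimately show thesis using that A.J_pos_contraction by blast
qed

section \<open>The semigroup generated by a nonnegative self-adjoint operator\<close>

lemma norm_power_diff_app_le:
  fixes P Q :: "'a::real_normed_vector endo"
  assumes comm: "P * Q = Q * P" and P: "\<And>k. k < n \<Longrightarrow> norm (P ^ k) \<le> c" and Q: "norm Q \<le> 1"
  shows "norm (app (P ^ n) x - app (Q ^ n) x) \<le> real n * (c * norm (app P x - app Q x))"
proof -
  define f where "f k = app (Q ^ (n - k) * P ^ k) x" for k
  have step: "norm (f (Suc k) - f k) \<le> c * norm (app P x - app Q x)" if "k \<in> {0..<n}" for k
  proof -
    define a where "a = n - Suc k"
    have a: "n - k = Suc a" using that by (auto simp: a_def)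
    have PQ: "P ^ k * Q = Q * P ^ k" using comm by (rule power_comm_mult)
    have "f (Suc k) - f k = app (Q ^ a * P ^ k * P - Q ^ a * (Q * P ^ k)) x"
    proof -
      have "f (Suc k) = app (Q ^ a * P ^ k * P) x"
        by (simp only: f_def a_def power_Suc2 mult.assoc)
      moreover have "f k = app (Q ^ a * (Q * P ^ k)) x"
        by (simp only: f_def a power_Suc2 mult.assoc)
      ultimately show ?thesis by (simp only: app.diff_left)
    qed
    also have "\<dots> = app (Q ^ a * P ^ k) (app P x - app Q x)"
      by (simp only: PQ[symmetric] mult.assoc[symmetric] app.diff_left app.diff_right app_mult)
    also have "norm \<dots> \<le> norm (Q ^ a * P ^ k) * norm (app P x - app Q x)" by (rule norm_app)
    also have "\<dots> \<le> c * norm (app P x - app Q x)"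
      using that by (intro mult_right_mono norm_mult_le_left norm_power_endo_le P Q) auto
    finally show ?thesis .
  qed
  have "app (P ^ n) x - app (Q ^ n) x = (\<Sum>k=0..<n. f (Suc k) - f k)"
    by (simp add: sum_Suc_diff') (simp add: f_def)
  also have "norm \<dots> \<le> (\<Sum>k=0..<n. c * norm (app P x - app Q x))" by (rule sum_norm_le[OF step])
  also have "\<dots> = real n * (c * norm (app P x - app Q x))" by simp
  finally show ?thesis .
qed

lemma power_mult_commuting:
  fixes A B :: "'a::monoid_mult"
  assumes "A * B = B * A"
  shows "(A * B) ^ n = A ^ n * B ^ n"
proof (induction n)
  case (Suc n)
  have "(A * B) ^ Suc n = A * (B * A ^ n) * B ^ n" by (simp add: Suc mult.assoc)
  also have "\<dots> = A * (A ^ n * B) * B ^ n" by (simp only: power_comm_mult[OF assms])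
  finally show ?case by (simp add: mult.assoc)
qed simp

lemma commute_mult:
  fixes A B C :: "'a::semigroup_mult"
  assumes "C * A = A * C" "C * B = B * C"
  shows "C * (A * B) = A * B * C"
proof -
  have "C * (A * B) = A * (C * B)" by (simp only: mult.assoc[symmetric] assms(1))
  also have "\<dots> = A * B * C" by (simp only: assms(2) mult.assoc)
  finally show ?thesis .
qed

lemma inverse_commute:
  fixes V Z C :: "'a::monoid_mult"
  assumes "V * Z = 1" "Z * V = 1" "Z * C = C * Z"
  shows "V * C = C * V"
proof -
  have "V * C = V * (C * Z) * V" by (simp add: assms mult.assoc)
  also have "\<dots> = V * Z * C * V" by (simp only: assms(3)[symmetric] mult.assoc)
  finally show ?thesis by (simp add: assms)
qed

context nonneg_self_adjoint
begin

text \<open>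
  For numbers \<open>h \<ge> 0\<close> in place of \<open>H\<close> put \<open>y = \<tau> h\<close> and \<open>g = (1 + y / m)\<^sup>-\<^sup>m\<close>. The inequalities of
  Bernoulli, \<open>1 - y \<le> g\<close> and \<open>g (1 + y) \<le> 1\<close>, say that \<open>0 \<le> y - (1 - g) \<le> y (1 - g)\<close>, so that the difference of
  \<open>1 / (1 + n (1 - g))\<close> and \<open>1 / (1 + n y)\<close> lies between \<open>0\<close> and
  \<open>n y (1 - g) / ((1 + n (1 - g)) (1 + n y)) \<le> 1 / n\<close>. Since \<open>X\<close> and
  \<open>Y\<close> below, which encode the two inequalities, are sums of products of commuting positive operators,
  the argument carries over.
\<close>

lemma norm_resolvent_step_diff:
  assumes \<tau>: "0 < \<tau>" and m: "0 < m" and n: "0 < n"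
    and V: "pos_contraction V" "V * (1 + real n *\<^sub>R (1 - J (\<tau> / real m) ^ m)) = 1"
      "(1 + real n *\<^sub>R (1 - J (\<tau> / real m) ^ m)) * V = 1"
  shows "norm (V - J (real n * \<tau>)) \<le> 1 / real n"
proof -
  define K where "K = J (\<tau> / real m)"
  define W where "W = J (real n * \<tau>)"
  define G where "G = K ^ m"
  define X where "X = 1 - W - real n *\<^sub>R ((1 - G) * W)"
  define Y where "Y = (1 - G) * (1 - W) - X"
  have pc: "pos_contraction K" "pos_contraction W" "pos_contraction (1 - W)" "pos_contraction (K ^ i)"
      "pos_contraction (1 - K ^ i)" "pos_contraction (1 - V)" for i
    by (auto simp: K_def W_def intro!: J_pos_contraction pos_contraction_one_minus
        pos_contraction_power V)
  have KW: "K * W = W * K" using \<tau> by (simp add: K_def W_def J_commute)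
  have KiW: "K ^ i * W = W * K ^ i" for i by (rule power_comm_mult[OF KW])
  have KiW': "K ^ i * (1 - W) = (1 - W) * K ^ i" for i by (simp add: algebra_simps KiW)
  have res: "K * (1 - W) = real (n * m) *\<^sub>R ((1 - K) * W)"
  proof -
    have "(\<tau> / real m) *\<^sub>R (K * (1 - W)) = (real n * \<tau>) *\<^sub>R ((1 - K) * W)"
      unfolding K_def W_def using \<tau> by (intro J_resolvent) auto
    then have "(real m / \<tau>) *\<^sub>R (\<tau> / real m) *\<^sub>R (K * (1 - W))
        = (real m / \<tau>) *\<^sub>R (real n * \<tau>) *\<^sub>R ((1 - K) * W)" by simp
    then show ?thesis using \<tau> m by (simp add: mult.commute)
  qed
  have geo: "(\<Sum>i<k. K ^ i * (1 - K)) = 1 - K ^ k" for k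
    by (induction k) (simp_all add: right_diff_distrib power_commutes)
  have X: "X = (1 / real m) *\<^sub>R (\<Sum>i<m. (1 - K ^ Suc i) * (1 - W))"
  proof -
    have "(\<Sum>i<m. K ^ Suc i * (1 - W)) = (\<Sum>i<m. real (n * m) *\<^sub>R (K ^ i * (1 - K) * W))"
      by (simp only: power_Suc2 mult.assoc res mult_scaleR_right)
    also have "\<dots> = real (n * m) *\<^sub>R ((1 - G) * W)"
      by (subst geo[of m, folded G_def, symmetric]) (simp only: scaleR_sum_right sum_distrib_right)
    finally have "(\<Sum>i<m. K ^ Suc i * (1 - W)) = real (n * m) *\<^sub>R ((1 - G) * W)" .
    then have "(1 / real m) *\<^sub>R (\<Sum>i<m. K ^ Suc i * (1 - W)) = real n *\<^sub>R ((1 - G) * W)"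
      using m by simp
    moreover have "(\<Sum>i<m. (1 - K ^ Suc i) * (1 - W)) = real m *\<^sub>R (1 - W) - (\<Sum>i<m. K ^ Suc i * (1 - W))"
    proof -
      have "(\<Sum>i<m. (1 - K ^ Suc i) * (1 - W)) = (\<Sum>i<m. (1 - W) - K ^ Suc i * (1 - W))"
        by (simp only: left_diff_distrib[of 1] mult_1_left)
      also have "\<dots> = (\<Sum>i<m. 1 - W) - (\<Sum>i<m. K ^ Suc i * (1 - W))" by (rule sum_subtractf)
      finally show ?thesis by (simp only: sum_constant_scaleR card_lessThan)
    qed
    ultimately show ?thesis using m by (simp add: X_def scaleR_diff_right)
  qed
  have Y: "Y = (1 / real m) *\<^sub>R (\<Sum>i<m. (K ^ Suc i - G) * (1 - W))"
  proof -
    have "(\<Sum>i<m. (K ^ Suc i - G) * (1 - W)) + (\<Sum>i<m. (1 - K ^ Suc i) * (1 - W))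
        = (\<Sum>i<m. (1 - G) * (1 - W))"
      unfolding sum.distrib[symmetric] distrib_right[symmetric] by simp
    also have "\<dots> = real m *\<^sub>R ((1 - G) * (1 - W))" by (simp only: sum_constant_scaleR card_lessThan)
    finally have "(\<Sum>i<m. (K ^ Suc i - G) * (1 - W))
        = real m *\<^sub>R ((1 - G) * (1 - W)) - (\<Sum>i<m. (1 - K ^ Suc i) * (1 - W))" by (simp add: algebra_simps)
    then show ?thesis using m by (simp add: Y_def X scaleR_diff_right)
  qed
  have posX: "pos_op X"
    unfolding X
  proof (intro positive_scaleR positive_sum)
    show "pos_op ((1 - K ^ Suc i) * (1 - W))" for i
      using pos_contraction_mult[OF pc(5)[of "Suc i"] pc(3)] KiW'[of "Suc i"]
      by (simp add: pos_contraction_def left_diff_distrib right_diff_distrib)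
  qed simp
  have posY: "pos_op Y"
    unfolding Y
  proof (intro positive_scaleR positive_sum)
    fix i assume "i \<in> {..<m}"
    then have im: "m = Suc i + (m - Suc i)" by simp
    have KK: "K ^ Suc i * (1 - K ^ (m - Suc i)) = (1 - K ^ (m - Suc i)) * K ^ Suc i"
      by (simp only: right_diff_distrib left_diff_distrib mult_1_left mult_1_right power_add[symmetric]
          add.commute)
    have eq: "K ^ Suc i - G = K ^ Suc i * (1 - K ^ (m - Suc i))"
      unfolding G_def by (subst im) (simp only: power_add right_diff_distrib mult_1_right)
    have "pos_contraction (K ^ Suc i - G)"
      unfolding eq by (intro pos_contraction_mult pc KK)
    moreover have "(K ^ Suc i - G) * (1 - W) = (1 - W) * (K ^ Suc i - G)"
      by (simp only: G_def left_diff_distrib[of "K ^ Suc i" "K ^ m"]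
          right_diff_distrib[of "1 - W" "K ^ Suc i" "K ^ m"] KiW')
    ultimately have "pos_contraction ((K ^ Suc i - G) * (1 - W))"
      by (intro pos_contraction_mult pc)
    then show "pos_op ((K ^ Suc i - G) * (1 - W))" by (simp add: pos_contraction_def)
  qed simp
  have VZ: "V * (1 + real n *\<^sub>R (1 - G)) = 1" "(1 + real n *\<^sub>R (1 - G)) * V = 1"
    using V by (simp_all add: G_def K_def)
  have VK: "V * K = K * V"
    by (rule inverse_commute[OF VZ]) (simp add: G_def algebra_simps power_commutes)
  have VW: "V * W = W * V"
    by (rule inverse_commute[OF VZ]) (simp add: G_def algebra_simps KiW)
  have VG: "V * G = G * V"
    unfolding G_def by (rule power_comm_mult[symmetric]) (rule VK[symmetric])
  have VGW: "V * (G * W) = G * W * V" by (metis VG VW mult.assoc)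
  have VX: "V * X = X * V"
    by (simp add: X_def algebra_simps VW VG VGW)
  have VY: "V * Y = Y * V"
    by (simp add: Y_def algebra_simps VW VG VGW VX)
  have "V - W = V * X"
  proof -
    have "V * X = V - V * (1 + real n *\<^sub>R (1 - G)) * W"
      by (simp add: X_def algebra_simps)
    then show ?thesis by (simp add: VZ)
  qed
  moreover have "norm (V * X) \<le> 1 / real n"
  proof (rule norm_le_if_positive)
    show "pos_op (V * X)" using V(1) posX VX by (intro positive_mult) (auto simp: pos_contraction_def)
    have "(1 - V) * (1 - W) = (1 - W) * (1 - V)" by (simp add: algebra_simps VW)
    then have "pos_op ((1 / real n) *\<^sub>R (1 - (1 - V) * (1 - W)) + V * Y)"
      using pos_contraction_mult[OF pc(6) pc(3)] V(1) posY VY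
      by (intro positive_add positive_scaleR positive_mult) (auto simp: pos_contraction_def)
    also have "1 - V = real n *\<^sub>R (V * (1 - G))" using VZ(1) by (simp add: algebra_simps)
    also have "(1 / real n) *\<^sub>R (1 - real n *\<^sub>R (V * (1 - G)) * (1 - W)) + V * Y = (1 / real n) *\<^sub>R 1 - V * X"
    proof -
      have "(real n *\<^sub>R (V * (1 - G))) * (1 - W) = real n *\<^sub>R (V * ((1 - G) * (1 - W)))"
        by (simp only: mult_scaleR_left mult.assoc)
      moreover have "V * Y = V * ((1 - G) * (1 - W)) - V * X"
        unfolding Y_def by (rule right_diff_distrib)
      ultimately show ?thesis
        using n by (simp only: scaleR_diff_right) simp
    qed
    finally show "pos_op ((1 / real n) *\<^sub>R 1 - V * X)" .
  qed simp
  ultimately show ?thesis by (simp add: W_def)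
qed

text \<open>The \<open>n\<close>-th approximation of \<open>e\<^sup>-\<^sup>t\<^sup>H\<close> by the implicit Euler scheme.\<close>

definition euler :: "real \<Rightarrow> nat \<Rightarrow> 'a endo" where
  "euler t n = J (t / real n) ^ n"

lemma norm_euler: "norm (euler t n) \<le> 1"
  unfolding euler_def by (intro norm_power_endo_le norm_J)

text \<open>
  \<open>J \<tau>\<close> and \<open>J (\<tau> / m) ^ m\<close> are two approximations of one step of length \<open>\<tau>\<close> whose resolvents
  are close to that of \<open>n \<tau> H\<close> by the preceding lemma; hence their \<open>n\<close>-th powers are close.
\<close>

lemma euler_refine:
  assumes t: "0 \<le> t" and n: "0 < n" and m: "0 < m"
  shows "norm (euler t n - euler t (n * m)) \<le> 108 / real n"
proof (cases "t = 0")
  case False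
  define \<tau> where "\<tau> = t / real n"
  have \<tau>: "0 < \<tau>" using t n False by (simp add: \<tau>_def)
  define F where "F = J \<tau>"
  define G where "G = J (\<tau> / real m) ^ m"
  have pc: "pos_contraction F" "pos_contraction G"
    by (auto simp: F_def G_def intro!: pos_contraction_power J_pos_contraction)
  have pos: "pos_op (real n *\<^sub>R (1 - F))" "pos_op (real n *\<^sub>R (1 - G))"
    using pc by (auto simp: pos_contraction_def intro: positive_scaleR)
  obtain R where R: "pos_contraction R" "R * (1 + real n *\<^sub>R (1 - F)) = 1" "(1 + real n *\<^sub>R (1 - F)) * R = 1"
    using resolvent_exists[OF pos(1)] by blast
  obtain Q where Q: "pos_contraction Q" "Q * (1 + real n *\<^sub>R (1 - G)) = 1" "(1 + real n *\<^sub>R (1 - G)) * Q = 1"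
    using resolvent_exists[OF pos(2)] by blast
  have 1: "norm (R - J (real n * \<tau>)) \<le> 1 / real n"
    by (rule norm_resolvent_step_diff[of \<tau> 1]) (use R n \<tau> in \<open>simp_all add: F_def\<close>)
  have 2: "norm (Q - J (real n * \<tau>)) \<le> 1 / real n"
    by (rule norm_resolvent_step_diff[of \<tau> m]) (use Q n m \<tau> in \<open>simp_all add: G_def\<close>)
  have "norm (R - Q) \<le> 1 / real n + 1 / real n"
    using norm_triangle_ineq4[of "R - J (real n * \<tau>)" "Q - J (real n * \<tau>)"] 1 2 by simp
  then have "54 * norm (R - Q) \<le> 108 / real n" by simp
  then have "norm (F ^ n - G ^ n) \<le> 108 / real n"
    using norm_power_diff_le_resolvent_diff[OF pc n R(2,3) Q(2,3)] by simp
  moreover have "F ^ n = euler t n" by (simp add: F_def euler_def \<tau>_def)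
  moreover have "G ^ n = euler t (n * m)"
    by (simp add: G_def euler_def \<tau>_def mult.commute[of n m] mult.commute[of "real n"] flip: power_mult)
  ultimately show ?thesis by simp
qed (simp add: euler_def)

definition T :: "real \<Rightarrow> 'a endo" where
  "T t = lim (euler t)"

lemma euler_tendsto_T:
  assumes t: "0 \<le> t"
  shows "euler t \<longlonglongrightarrow> T t"
proof -
  have "Cauchy (euler t)"
  proof (rule CauchyI)
    fix e :: real assume e: "0 < e"
    obtain N where N: "216 / e < real N" using reals_Archimedean2 by blast
    have "0 < 216 / e" using e by simp
    then have N0: "0 < N" using N by (cases N) auto
    have "norm (euler t a - euler t b) < e" if ab: "a \<ge> N" "b \<ge> N" for a b
    proof -
      have small: "108 / real c < e / 2" if "c \<ge> N" for c
      proof -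
        have "216 / e < real c" using N that by linarith
        moreover have "0 < real c" using that N0 by simp
        ultimately show ?thesis using e by (simp add: field_simps)
      qed
      have pos: "0 < a" "0 < b" using ab N0 by auto
      have "norm (euler t a - euler t b)
          \<le> norm (euler t a - euler t (a * b)) + norm (euler t b - euler t (b * a))"
        using norm_triangle_ineq4[of "euler t a - euler t (a * b)" "euler t b - euler t (b * a)"]
        by (simp add: mult.commute)
      also have "\<dots> \<le> 108 / real a + 108 / real b"
        by (intro add_mono euler_refine t pos)
      also have "\<dots> < e" using small[OF ab(1)] small[OF ab(2)] by simp
      finally show ?thesis .
    qed
    then show "\<exists>M. \<forall>m\<ge>M. \<forall>n\<ge>M. norm (euler t m - euler t n) < e" by blast
  qed
  then show ?thesis unfolding T_def by (simp add: Cauchy_convergent flip: convergent_LIMSEQ_iff)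
qed

lemma norm_euler_minus_T:
  assumes t: "0 \<le> t" and n: "0 < n"
  shows "norm (euler t n - T t) \<le> 108 / real n"
proof (rule LIMSEQ_le_const2)
  have "strict_mono (\<lambda>m. n * Suc m)" using n by (simp add: strict_mono_Suc_iff)
  then have "(euler t \<circ> (\<lambda>m. n * Suc m)) \<longlonglongrightarrow> T t" by (rule LIMSEQ_subseq_LIMSEQ[OF euler_tendsto_T[OF t]])
  then show "(\<lambda>m. norm (euler t n - euler t (n * Suc m))) \<longlonglongrightarrow> norm (euler t n - T t)"
    unfolding comp_def by (intro tendsto_intros)
  show "\<exists>N. \<forall>m\<ge>N. norm (euler t n - euler t (n * Suc m)) \<le> 108 / real n"
    using euler_refine[OF t n] by blast
qed

lemma norm_T: "0 \<le> t \<Longrightarrow> norm (T t) \<le> 1"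
  by (rule LIMSEQ_le_const2[OF tendsto_norm[OF euler_tendsto_T]]) (auto intro: norm_euler)

lemma hermitian_T: "0 \<le> t \<Longrightarrow> hermitian (T t)"
proof (rule hermitian_limit[OF _ euler_tendsto_T])
  show "hermitian (euler t n)" for n
    unfolding euler_def using J_pos_contraction
    by (intro hermitian_power) (auto simp: pos_contraction_def intro: positive_hermitian)
qed

lemma T_0 [simp]: "T 0 = 1"
proof (rule LIMSEQ_unique[OF euler_tendsto_T])
  have "euler 0 = (\<lambda>n. 1)" by (simp add: fun_eq_iff euler_def)
  then show "euler 0 \<longlonglongrightarrow> 1" by simp
qed simp

lemma euler_app_tendsto: "0 \<le> t \<Longrightarrow> (\<lambda>n. app (euler t n) x) \<longlonglongrightarrow> app (T t) x"
  by (intro app.tendsto euler_tendsto_T tendsto_const)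

lemma norm_J_power_minus_id:
  assumes "x \<in> D" "0 \<le> h"
  shows "norm (app (J h ^ k) x - x) \<le> real k * h * norm (H x)"
proof -
  have "norm (app (J h ^ k) x - app (1 ^ k) x) \<le> real k * (1 * norm (app (J h) x - app 1 x))"
    by (intro norm_power_diff_app_le norm_power_endo_le norm_J norm_one_endo_le) simp
  also have "norm (app (J h) x - app 1 x) = norm (h *\<^sub>R app (J h) (H x))"
    using one_minus_J[OF assms] by (simp add: norm_minus_commute)
  also have "\<dots> \<le> h * (1 * norm (H x))"
    using norm_app[of "J h" "H x"] mult_right_mono[OF norm_J norm_ge_zero, of h "H x"] assms
    by (simp add: mult_left_mono)
  finally show ?thesis by (simp add: mult_left_mono)
qed

text \<open>Density of the domain turns bounds on the domain into statements about all vectors.\<close>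

lemma norm_app_minus_id:
  assumes "norm A \<le> 1" "norm (app A w - w) \<le> b"
  shows "norm (app A z - z) \<le> 2 * norm (z - w) + b"
proof -
  have "app A z - z = app A (z - w) + (app A w - w) - (z - w)" by (simp add: app_simps)
  also have "norm \<dots> \<le> norm (app A (z - w)) + norm (app A w - w) + norm (z - w)"
    by (meson add_right_mono norm_triangle_ineq norm_triangle_ineq4 order_trans)
  also have "\<dots> \<le> 1 * norm (z - w) + b + norm (z - w)"
    using norm_app[of A "z - w"] mult_right_mono[OF assms(1) norm_ge_zero, of "z - w"] assms(2)
    by linarith
  finally show ?thesis by simp
qed

lemma close_in_D:
  assumes "0 < e"
  obtains w where "w \<in> D" "norm (z - w) < e"
  using dense_D closure_approachable[of z D] assms by (auto simp: dist_norm norm_minus_commute)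

lemma tendsto_id_if_domain_bound:
  assumes A: "\<And>h. 0 \<le> h \<Longrightarrow> norm (A h) \<le> 1"
    and b: "\<And>h w. 0 \<le> h \<Longrightarrow> w \<in> D \<Longrightarrow> norm (app (A h) w - w) \<le> h * norm (H w)"
  shows "((\<lambda>h. app (A h) z) \<longlongrightarrow> z) (at_right 0)"
proof (rule tendstoI)
  fix e :: real assume e: "0 < e"
  obtain w where w: "w \<in> D" "norm (z - w) < e / 4" using close_in_D[of "e / 4"] e by auto
  define d where "d = e / (2 * (norm (H w) + 1))"
  have pos: "0 < norm (H w) + 1" by (simp add: add_nonneg_pos)
  then have d: "0 < d" using e by (simp add: d_def)
  have "dist (app (A h) z) z < e" if "0 < h" "h < d" for h
  proof -
    have "norm (app (A h) z - z) \<le> 2 * norm (z - w) + h * norm (H w)"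
      using that by (intro norm_app_minus_id A b w) auto
    also have "h * norm (H w) \<le> d * (norm (H w) + 1)" using that by (intro mult_mono) auto
    also have "\<dots> = e / 2" using pos by (simp add: d_def field_simps del: distrib_left_numeral)
    finally show ?thesis using w by (simp add: dist_norm)
  qed
  then show "\<forall>\<^sub>F h in at_right 0. dist (app (A h) z) z < e"
    using d by (auto simp: eventually_at_right_field)
qed

lemma J_tendsto_id: "((\<lambda>h. app (J h) z) \<longlongrightarrow> z) (at_right 0)"
  using norm_J_power_minus_id[of _ _ 1] by (intro tendsto_id_if_domain_bound norm_J) auto

lemma norm_T_minus_id:
  assumes "x \<in> D" "0 \<le> t"
  shows "norm (app (T t) x - x) \<le> t * norm (H x)"
proof (rule LIMSEQ_le_const2)
  show "(\<lambda>n. norm (app (euler t n) x - x)) \<longlonglongrightarrow> norm (app (T t) x - x)"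
    by (intro tendsto_intros euler_app_tendsto assms)
  show "\<exists>N. \<forall>n\<ge>N. norm (app (euler t n) x - x) \<le> t * norm (H x)"
  proof (intro exI[of _ 1] allI impI)
    fix n :: nat assume "1 \<le> n"
    then show "norm (app (euler t n) x - x) \<le> t * norm (H x)"
      using norm_J_power_minus_id[OF assms(1), of "t / real n" n] assms(2) by (simp add: euler_def)
  qed
qed

text \<open>
  With \<open>u = J a (J b x)\<close> one has \<open>x = (1 + b H) (1 + a H) u = (1 + (a + b) H) u + a b H\<^sup>2 u\<close>. With
  \<open>w = J b x\<close> the last term is \<open>b (H w - H u)\<close>, which makes sense for all \<open>x \<in> D\<close>. The bound is \<open>b\<close>
  times a quantity that vanishes as \<open>a\<close> tends to \<open>0\<close>, so that it survives summation over \<open>n\<close> steps of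
  length \<open>t / n\<close>.
\<close>

lemma norm_J_add_diff:
  assumes x: "x \<in> D" and ab: "0 < a" "0 < b"
  shows "norm (app (J (a + b)) x - app (J a * J b) x) \<le> b * norm (app (J a) (H x) - H x)"
proof -
  define w where "w = app (J b) x"
  define u where "u = app (J a) w"
  have D: "w \<in> D" "u \<in> D" using ab by (auto simp: w_def u_def intro: J_in_D)
  have 1: "w = u + a *\<^sub>R H u" using J_right[OF ab(1), of w] by (simp add: u_def)
  have 2: "x = w + b *\<^sub>R H w" using J_right[OF ab(2), of x] by (simp add: w_def)
  have Hu: "H u = app (J a) (H w)" using H_J[OF D(1)] ab by (simp add: u_def)
  have Hw: "H w = app (J b) (H x)" using H_J[OF x] ab by (simp add: w_def)
  have "x = (u + (a + b) *\<^sub>R H u) + b *\<^sub>R (H w - H u)"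
    by (subst 2, subst 1) (simp add: scaleR_add_left scaleR_diff_right)
  then have "app (J (a + b)) x = app (J (a + b)) (u + (a + b) *\<^sub>R H u) + app (J (a + b)) (b *\<^sub>R (H w - H u))"
    by (metis app.add_right)
  also have "app (J (a + b)) (u + (a + b) *\<^sub>R H u) = u" using ab D by (intro J_left) auto
  finally have "app (J (a + b)) x - app (J a * J b) x = b *\<^sub>R app (J (a + b)) (H w - H u)"
    by (simp add: u_def w_def app.scaleR_right)
  also have "H w - H u = app (J b) (H x - app (J a) (H x))"
  proof -
    have "app (J a * J b) (H x) = app (J b * J a) (H x)" using J_commute[of a b] ab by simp
    then show ?thesis by (simp add: Hu Hw app.diff_right)
  qed
  also have "norm (b *\<^sub>R app (J (a + b)) (app (J b) (H x - app (J a) (H x))))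
      = b * norm (app (J (a + b) * J b) (H x - app (J a) (H x)))"
    using ab by simp
  also have "\<dots> \<le> b * (1 * norm (H x - app (J a) (H x)))"
    using ab by (intro mult_left_mono order_trans[OF norm_app] mult_right_mono norm_mult_le_left norm_J) auto
  finally show ?thesis by (simp add: norm_minus_commute)
qed

lemma endo_eq_if_eq_on_D:
  assumes "\<And>x. x \<in> D \<Longrightarrow> app A x = app B x"
  shows "A = B"
proof (rule endo_eqI)
  fix x
  have "closed {x. app A x = app B x}"
    by (intro closed_Collect_eq continuous_intros app.continuous_on)
  moreover have "D \<subseteq> {x. app A x = app B x}" using assms by auto
  ultimately have "closure D \<subseteq> {x. app A x = app B x}" by (simp add: closure_minimal)
  then show "app A x = app B x" using dense_D by auto
qed

lemma T_add:
  assumes st: "0 \<le> s" "0 \<le> t"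
  shows "T (s + t) = T s * T t"
proof (cases "s = 0 \<or> t = 0")
  case False
  then have st': "0 < s" "0 < t" using st by auto
  show ?thesis
  proof (rule endo_eq_if_eq_on_D)
    fix x assume x: "x \<in> D"
    have "norm (app (euler (s + t) n) x - app (euler s n * euler t n) x)
        \<le> t * norm (app (J (s / real n)) (H x) - H x)" if "n \<ge> 1" for n
    proof -
      define a b where "a = s / real n" and "b = t / real n"
      have ab: "0 < a" "0 < b" using st' that by (auto simp: a_def b_def)
      have ab_sum: "(s + t) / real n = a + b" by (simp add: a_def b_def add_divide_distrib)
      have comm: "J a * J b = J b * J a" using ab by (intro J_commute) auto
      have comm': "J (a + b) * (J a * J b) = J a * J b * J (a + b)"
      proof -
        have "J (a + b) * J a = J a * J (a + b)" "J (a + b) * J b = J b * J (a + b)"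
          using ab by (auto intro!: J_commute)
        then show ?thesis by (rule commute_mult)
      qed
      have "(J a * J b) ^ n = J a ^ n * J b ^ n" by (rule power_mult_commuting[OF comm])
      then have "euler s n * euler t n = (J a * J b) ^ n" by (simp add: euler_def a_def b_def)
      then have "norm (app (euler (s + t) n) x - app (euler s n * euler t n) x)
          \<le> real n * (1 * norm (app (J (a + b)) x - app (J a * J b) x))"
        unfolding euler_def ab_sum
        using norm_power_diff_app_le[OF comm', of n 1 x]
        by (simp add: norm_power_endo_le norm_J norm_mult_le_left)
      also have "\<dots> \<le> real n * (1 * (b * norm (app (J a) (H x) - H x)))"
        by (intro mult_left_mono norm_J_add_diff x ab) auto
      also have "\<dots> = t * norm (app (J a) (H x) - H x)" using that by (simp add: b_def)
      finally show ?thesis by (simp add: a_def)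
    qed
    then have le: "\<forall>\<^sub>F n in sequentially. norm (app (euler (s + t) n) x - app (euler s n * euler t n) x)
        \<le> t * norm (app (J (s / real n)) (H x) - H x)"
      by (auto simp: eventually_sequentially)
    have "filterlim (\<lambda>n. s / real n) (at_right 0) sequentially"
      unfolding filterlim_at using st' lim_const_over_n[of s]
      by (auto simp: eventually_sequentially intro!: exI[of _ 1])
    then have "(\<lambda>n. app (J (s / real n)) (H x)) \<longlonglongrightarrow> H x"
      by (rule filterlim_compose[OF J_tendsto_id])
    then have "(\<lambda>n. t * norm (app (J (s / real n)) (H x) - H x)) \<longlonglongrightarrow> t * norm (H x - H x)"
      by (intro tendsto_intros)
    then have "(\<lambda>n. t * norm (app (J (s / real n)) (H x) - H x)) \<longlonglongrightarrow> 0" by simp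
    then have "(\<lambda>n. app (euler (s + t) n) x - app (euler s n * euler t n) x) \<longlonglongrightarrow> 0"
      by (rule Lim_null_comparison[OF le])
    moreover have "(\<lambda>n. app (euler (s + t) n) x - app (euler s n * euler t n) x)
        \<longlonglongrightarrow> app (T (s + t)) x - app (T s * T t) x"
      by (intro tendsto_intros app.tendsto tendsto_mult euler_tendsto_T add_nonneg_nonneg st)
    ultimately show "app (T (s + t)) x = app (T s * T t) x"
      using LIMSEQ_unique by fastforce
  qed
qed auto

end

section \<open>Uniqueness of the semigroup\<close>

text \<open>
  Strong continuity at \<open>0\<close> makes each orbit bounded near \<open>0\<close>. By the Baire category theorem one of
  the closed sets of vectors whose orbits satisfy a common bound on a common interval has an interior
  point, which gives a bound for the operator norms.
\<close>

lemma C0_semigroup_bounded_near_0: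
  fixes U :: "real \<Rightarrow> ('a::complex_hilbert_space \<Rightarrow>\<^sub>L 'a)"
  assumes U: "C0_semigroup U"
  obtains \<delta> B where "0 < \<delta>" "0 \<le> B" "\<And>s. 0 \<le> s \<Longrightarrow> s \<le> \<delta> \<Longrightarrow> norm (U s) \<le> B"
proof -
  define C where "C k = {x. \<forall>s\<in>{0..1 / real (Suc k)}. norm (blinfun_apply (U s) x) \<le> real k}" for k
  have lim: "((\<lambda>t. blinfun_apply (U t) x) \<longlongrightarrow> x) (at_right 0)" and U0: "U 0 = id_blinfun" for x
    using U by (auto simp: C0_semigroup_def)
  have closed_C: "closed (C k)" for k
  proof -
    have "C k = (\<Inter>s\<in>{0..1 / real (Suc k)}. {x. norm (blinfun_apply (U s) x) \<le> real k})"
      by (auto simp: C_def)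
    moreover have "closed {x. norm (blinfun_apply (U s) x) \<le> real k}" for s
      by (intro closed_Collect_le continuous_intros)
    ultimately show ?thesis by auto
  qed
  have "x \<in> (\<Union>k. C k)" for x
  proof -
    have "\<forall>\<^sub>F t in at_right 0. dist (blinfun_apply (U t) x) x < 1" using lim by (rule tendstoD) simp
    then obtain b where b: "0 < b" "\<And>t. 0 < t \<Longrightarrow> t < b \<Longrightarrow> dist (blinfun_apply (U t) x) x < 1"
      by (auto simp: eventually_at_right_field)
    obtain k where k: "max (1 / b) (norm x + 1) < real k" using reals_Archimedean2 by blast
    have "norm (blinfun_apply (U s) x) \<le> real k" if s: "0 \<le> s" "s \<le> 1 / real (Suc k)" for s
    proof (cases "s = 0")
      case True
      then show ?thesis using k by (simp add: U0)
    next
      case False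
      have "1 / b < real (Suc k)" using k by simp
      then have "1 / real (Suc k) < b" using b(1) by (simp add: field_simps del: of_nat_Suc)
      then have "dist (blinfun_apply (U s) x) x < 1" using s False by (intro b) auto
      then have "norm (blinfun_apply (U s) x - x) < 1" by (simp add: dist_norm)
      then show ?thesis
        using k norm_triangle_ineq2[of "blinfun_apply (U s) x" x] by simp
    qed
    then have "x \<in> C k" by (simp add: C_def)
    then show ?thesis by blast
  qed
  then have UN: "\<Union>(range C) = UNIV" by auto
  have "\<exists>k. interior (C k) \<noteq> {}"
  proof (rule ccontr)
    assume "\<not> ?thesis"
    then have "euclidean interior_of \<Union>(range C) = {}"
      using closed_C
      by (intro Baire_category_alt) (auto simp: completely_metrizable_space_euclidean)
    then show False by (simp add: UN)
  qed
  then obtain k x where "x \<in> interior (C k)" by auto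
  then obtain r where r: "0 < r" "cball x r \<subseteq> C k" by (auto simp: mem_interior_cball)
  have "norm (U s) \<le> 2 * real k / r" if s: "0 \<le> s" "s \<le> 1 / real (Suc k)" for s
  proof (rule norm_blinfun_bound)
    fix z
    have C: "norm (blinfun_apply (U s) y) \<le> real k" if "y \<in> C k" for y
      using that s by (auto simp: C_def)
    show "norm (blinfun_apply (U s) z) \<le> 2 * real k / r * norm z"
    proof (cases "z = 0")
      case False
      define y where "y = (r / norm z) *\<^sub>R z"
      have "norm y = r" using False r by (simp add: y_def)
      then have "x + y \<in> C k" "x \<in> C k" using r by (auto simp: dist_norm)
      then have "norm (blinfun_apply (U s) (x + y) - blinfun_apply (U s) x) \<le> real k + real k"
        by (intro norm_triangle_le_diff add_mono C)
      then have "norm (blinfun_apply (U s) y) \<le> 2 * real k" by (simp add: blinfun.bilinear_simps)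
      moreover have "norm (blinfun_apply (U s) y) = r / norm z * norm (blinfun_apply (U s) z)"
        using r by (simp add: y_def blinfun.bilinear_simps)
      ultimately show ?thesis using False r by (simp add: field_simps)
    qed simp
  qed (use r in simp)
  then show thesis using r by (intro that[of "1 / real (Suc k)" "2 * real k / r"]) auto
qed

lemma C0_semigroup_multiple:
  assumes U: "C0_semigroup U" and h: "0 \<le> h"
  shows "endo (U (real k * h)) = endo (U h) ^ k"
proof (induction k)
  case 0
  show ?case using U by (simp add: C0_semigroup_def one_endo_def)
next
  case (Suc k)
  have "U (h + real k * h) = U h o\<^sub>L U (real k * h)" using U h by (simp add: C0_semigroup_def)
  then have "endo (U (h + real k * h)) = endo (U h) * endo (U (real k * h))"
    by (simp add: times_endo_def map_fun_def endo_inverse)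
  moreover have "h + real k * h = real (Suc k) * h" by (simp add: algebra_simps)
  ultimately show ?case by (simp only: Suc power_Suc)
qed

lemma norm_endo_eq: "norm (endo A) = norm A"
  by (simp add: norm_endo.rep_eq endo_inverse)

lemma app_endo: "app (endo A) = blinfun_apply A"
  by (simp add: app_def endo_inverse)

lemma C0_semigroup_bounded:
  fixes U :: "real \<Rightarrow> ('a::complex_hilbert_space \<Rightarrow>\<^sub>L 'a)"
  assumes U: "C0_semigroup U"
  obtains B where "0 \<le> B" "\<And>s. 0 \<le> s \<Longrightarrow> s \<le> t \<Longrightarrow> norm (U s) \<le> B"
proof -
  obtain \<delta> B where \<delta>: "0 < \<delta>" "0 \<le> B" "\<And>s. 0 \<le> s \<Longrightarrow> s \<le> \<delta> \<Longrightarrow> norm (U s) \<le> B"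
    using C0_semigroup_bounded_near_0[OF U] by blast
  obtain N where N: "t / \<delta> < real (Suc N)" using reals_Archimedean2 less_Suc_eq of_nat_less_iff
    by (metis lessI order_less_trans)
  have "norm (U s) \<le> max 1 B ^ Suc N" if s: "0 \<le> s" "s \<le> t" for s
  proof -
    define h where "h = s / real (Suc N)"
    have "t < \<delta> * real (Suc N)" using N \<delta>(1) by (simp add: field_simps del: of_nat_Suc)
    then have h: "0 \<le> h" "h \<le> \<delta>" using s by (auto simp: h_def field_simps simp del: of_nat_Suc)
    have pow: "norm (endo (U h) ^ k) \<le> max 1 B ^ k" for k
    proof (induction k)
      case (Suc k)
      have "norm (endo (U h)) \<le> max 1 B" using \<delta>(3)[OF h] by (simp add: norm_endo_eq)
      then show ?case using norm_mult_le[OF _ Suc] by simp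
    qed (simp add: norm_one_endo_le)
    have "real (Suc N) * h = s" by (simp add: h_def)
    then have "endo (U s) = endo (U h) ^ Suc N" using C0_semigroup_multiple[OF U h(1), of "Suc N"] by simp
    then show ?thesis using pow[of "Suc N"] by (metis norm_endo_eq)
  qed
  then show thesis by (intro that[of "max 1 B ^ Suc N"]) auto
qed

context nonneg_self_adjoint
begin

lemma norm_J_power_derivative:
  assumes x: "x \<in> D" and w: "w \<in> D" and h: "0 \<le> h"
  shows "norm (app (J h ^ m) x - x + (real m * h) *\<^sub>R H x)
    \<le> real m * h * (2 * norm (H x - w) + real m * h * norm (H w))"
proof (induction m)
  case (Suc m)
  let ?b = "\<lambda>m. 2 * norm (H x - w) + real m * h * norm (H w)"
  have "app (J h) x - x = - (h *\<^sub>R app (J h) (H x))"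
    using one_minus_J[OF x h] by (metis minus_diff_eq)
  then have "app (J h ^ m) (app (J h) x) - app (J h ^ m) x = - (h *\<^sub>R app (J h ^ m) (app (J h) (H x)))"
    by (metis app.diff_right app.minus_right app.scaleR_right)
  then have "app (J h ^ Suc m) x - app (J h ^ m) x = - (h *\<^sub>R app (J h ^ Suc m) (H x))"
    by (simp add: power_Suc2 del: power_Suc)
  then have "app (J h ^ Suc m) x - x + (real (Suc m) * h) *\<^sub>R H x
      = (app (J h ^ m) x - x + (real m * h) *\<^sub>R H x) - h *\<^sub>R (app (J h ^ Suc m) (H x) - H x)"
    by (simp add: algebra_simps)
  also have "norm \<dots> \<le> real m * h * ?b m + h * ?b (Suc m)"
  proof (intro norm_triangle_le_diff add_mono Suc.IH)
    have "norm (app (J h ^ Suc m) (H x) - H x) \<le> ?b (Suc m)"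
      by (intro norm_app_minus_id norm_power_endo_le norm_J norm_J_power_minus_id w h)
    then show "norm (h *\<^sub>R (app (J h ^ Suc m) (H x) - H x)) \<le> h * ?b (Suc m)"
      using h by (simp add: mult_left_mono del: power_Suc)
  qed
  also have "\<dots> \<le> real m * h * ?b (Suc m) + h * ?b (Suc m)"
    using h by (intro add_mono mult_left_mono mult_right_mono) auto
  also have "\<dots> = real (Suc m) * h * ?b (Suc m)" by (simp add: algebra_simps)
  finally show ?case .
qed simp

lemma T_derivative:
  assumes x: "x \<in> D"
  shows "((\<lambda>h. (1 / h) *\<^sub>R (app (T h) x - x)) \<longlongrightarrow> - H x) (at_right 0)"
proof (rule tendstoI)
  fix e :: real assume e: "0 < e"
  obtain w where w: "w \<in> D" "norm (H x - w) < e / 4" using close_in_D[of "e / 4"] e by auto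
  have bound: "norm (app (T t) x - x + t *\<^sub>R H x) \<le> t * (2 * norm (H x - w) + t * norm (H w))"
    if t: "0 < t" for t
  proof (rule LIMSEQ_le_const2)
    show "(\<lambda>n. norm (app (euler t n) x - x + t *\<^sub>R H x)) \<longlonglongrightarrow> norm (app (T t) x - x + t *\<^sub>R H x)"
      using t by (intro tendsto_intros euler_app_tendsto) auto
    show "\<exists>N. \<forall>n\<ge>N. norm (app (euler t n) x - x + t *\<^sub>R H x)
        \<le> t * (2 * norm (H x - w) + t * norm (H w))"
    proof (intro exI[of _ 1] allI impI)
      fix n :: nat assume "1 \<le> n"
      then show "norm (app (euler t n) x - x + t *\<^sub>R H x) \<le> t * (2 * norm (H x - w) + t * norm (H w))"
        using norm_J_power_derivative[OF x w(1), of "t / real n" n] t by (simp add: euler_def)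
    qed
  qed
  define d where "d = e / (2 * (norm (H w) + 1))"
  have pos: "0 < norm (H w) + 1" by (simp add: add_nonneg_pos)
  then have d: "0 < d" using e by (simp add: d_def)
  have "dist ((1 / t) *\<^sub>R (app (T t) x - x)) (- H x) < e" if t: "0 < t" "t < d" for t
  proof -
    have "(1 / t) *\<^sub>R (app (T t) x - x) - - H x = (1 / t) *\<^sub>R (app (T t) x - x + t *\<^sub>R H x)"
      using t by (simp add: scaleR_add_right)
    then have "dist ((1 / t) *\<^sub>R (app (T t) x - x)) (- H x) = (1 / t) * norm (app (T t) x - x + t *\<^sub>R H x)"
      using t by (simp only: dist_norm norm_scaleR) simp
    also have "\<dots> \<le> (1 / t) * (t * (2 * norm (H x - w) + t * norm (H w)))"
      using t by (intro mult_left_mono bound) auto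
    also have "\<dots> = 2 * norm (H x - w) + t * norm (H w)" using t by simp
    also have "t * norm (H w) \<le> d * (norm (H w) + 1)" using t by (intro mult_mono) auto
    also have "\<dots> = e / 2" using pos by (simp add: d_def field_simps del: distrib_left_numeral)
    finally show ?thesis using w by simp
  qed
  then show "\<forall>\<^sub>F h in at_right 0. dist ((1 / h) *\<^sub>R (app (T h) x - x)) (- H x) < e"
    using d by (auto simp: eventually_at_right_field)
qed

lemma C0_semigroup_T: "C0_semigroup (\<lambda>t. blin (T t))"
  unfolding C0_semigroup_def
proof (intro conjI allI impI)
  show "linear_operator UNIV (blinfun_apply (blin (T t)))" if "0 \<le> t" for t
    using that
    by (simp add: linear_operator_def app_simps hermitian_scaleC hermitian_T flip: app_def)
  show "blin (T 0) = id_blinfun" by (simp add: one_endo.rep_eq)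
  show "blin (T (s + t)) = blin (T s) o\<^sub>L blin (T t)" if "0 \<le> s" "0 \<le> t" for s t
    using that by (simp add: T_add times_endo.rep_eq)
  show "((\<lambda>t. blinfun_apply (blin (T t)) x) \<longlongrightarrow> x) (at_right 0)" for x
    unfolding app_def[symmetric]
    by (rule tendsto_id_if_domain_bound) (auto intro: norm_T norm_T_minus_id)
qed

text \<open>
  The generator of \<^term>\<open>T\<close> extends \<open>- H\<close> and is symmetric because \<^term>\<open>T\<close> is; a self-adjoint
  operator has no proper symmetric extension.
\<close>

lemma generator_graph_T: "generator_graph (\<lambda>t. blin (T t)) = operator_graph D (\<lambda>x. - H x)"
proof (intro equalityI subsetI)
  fix p assume "p \<in> operator_graph D (\<lambda>x. - H x)"
  then show "p \<in> generator_graph (\<lambda>t. blin (T t))"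
    using T_derivative by (auto simp: operator_graph_def generator_graph_def simp flip: app_def)
next
  fix p assume p: "p \<in> generator_graph (\<lambda>t. blin (T t))"
  obtain x y where xy: "p = (x, y)" by (cases p)
  have y: "((\<lambda>h. (1 / h) *\<^sub>R (app (T h) x - x)) \<longlongrightarrow> y) (at_right 0)"
    using p by (simp add: xy generator_graph_def flip: app_def)
  have "x \<in> D \<and> - y = H x"
  proof (rule H_maximal)
    fix z assume z: "z \<in> D"
    have 1: "((\<lambda>h. cinner ((1 / h) *\<^sub>R (app (T h) x - x)) z) \<longlongrightarrow> cinner y z) (at_right 0)"
      by (intro cinner.tendsto y tendsto_const)
    have 2: "((\<lambda>h. cinner x ((1 / h) *\<^sub>R (app (T h) z - z))) \<longlongrightarrow> cinner x (- H z)) (at_right 0)"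
      by (intro cinner.tendsto T_derivative z tendsto_const)
    have "\<forall>\<^sub>F h in at_right 0. cinner ((1 / h) *\<^sub>R (app (T h) x - x)) z
        = cinner x ((1 / h) *\<^sub>R (app (T h) z - z))"
      using eventually_at_right_less
    proof (rule eventually_mono)
      fix h :: real assume "0 < h"
      then show "cinner ((1 / h) *\<^sub>R (app (T h) x - x)) z = cinner x ((1 / h) *\<^sub>R (app (T h) z - z))"
        by (simp add: cinner_scaleR_left cinner_scaleR_right cinner_diff_left cinner_diff_right
            hermitianD[OF hermitian_T])
    qed
    with 2 have "((\<lambda>h. cinner ((1 / h) *\<^sub>R (app (T h) x - x)) z) \<longlongrightarrow> cinner x (- H z)) (at_right 0)"
      by (simp add: tendsto_cong)
    then have "cinner y z = cinner x (- H z)" using 1 tendsto_unique trivial_limit_at_right_real by blast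
    then show "cinner x (H z) = cinner (- y) z" by (simp add: cinner_minus_left cinner_minus_right)
  qed
  then show "p \<in> operator_graph D (\<lambda>x. - H x)" by (simp add: xy operator_graph_def) (metis minus_minus)
qed

text \<open>
  A semigroup \<open>U\<close> with generator \<open>- H\<close> preserves the domain and commutes with \<open>H\<close>, hence with the
  resolvents and with \<^term>\<open>T\<close>. On the domain, \<open>n\<close> steps of length \<open>t / n\<close> therefore accumulate a
  difference of at most a constant times \<open>n \<parallel>U (t / n) x - T (t / n) x\<parallel>\<close>, and
  this tends to \<open>0\<close> since both semigroups have the derivative \<open>- H x\<close> at \<open>0\<close>.
\<close>

lemma semigroup_unique:
  fixes U :: "real \<Rightarrow> ('a \<Rightarrow>\<^sub>L 'a)"
  assumes U: "C0_semigroup U" and gen: "generator_graph U = operator_graph D (\<lambda>x. - H x)" and t: "0 \<le> t"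
  shows "U t = blin (T t)"
proof -
  have U_add: "U (r + s) = U r o\<^sub>L U s" if "0 \<le> r" "0 \<le> s" for r s
    using U that by (auto simp: C0_semigroup_def)
  have U_deriv: "((\<lambda>h. (1 / h) *\<^sub>R (blinfun_apply (U h) x - x)) \<longlongrightarrow> - H x) (at_right 0)"
    if "x \<in> D" for x
  proof -
    have "(x, - H x) \<in> generator_graph U" using gen that by (auto simp: operator_graph_def)
    then show ?thesis by (simp add: generator_graph_def)
  qed
  have inv: "blinfun_apply (U s) x \<in> D \<and> H (blinfun_apply (U s) x) = blinfun_apply (U s) (H x)"
    if x: "x \<in> D" and s: "0 \<le> s" for x s
  proof -
    let ?u = "blinfun_apply (U s)"
    have "((\<lambda>h. ?u ((1 / h) *\<^sub>R (blinfun_apply (U h) x - x))) \<longlongrightarrow> ?u (- H x)) (at_right 0)"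
      by (intro blinfun.tendsto tendsto_const U_deriv x)
    moreover have "\<forall>\<^sub>F h in at_right 0. ?u ((1 / h) *\<^sub>R (blinfun_apply (U h) x - x))
        = (1 / h) *\<^sub>R (blinfun_apply (U h) (?u x) - ?u x)"
      using eventually_at_right_less
    proof (rule eventually_mono)
      fix h :: real assume h: "0 < h"
      have "?u (blinfun_apply (U h) x) = blinfun_apply (U h) (?u x)"
        using U_add[of s h] U_add[of h s] h s
        by (simp add: add.commute flip: blinfun_apply_blinfun_compose)
      then show "?u ((1 / h) *\<^sub>R (blinfun_apply (U h) x - x)) = (1 / h) *\<^sub>R (blinfun_apply (U h) (?u x) - ?u x)"
        by (simp add: blinfun.bilinear_simps)
    qed
    ultimately have "((\<lambda>h. (1 / h) *\<^sub>R (blinfun_apply (U h) (?u x) - ?u x)) \<longlongrightarrow> ?u (- H x)) (at_right 0)"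
      by (simp add: tendsto_cong)
    then have "(?u x, ?u (- H x)) \<in> generator_graph U" by (simp add: generator_graph_def)
    then show ?thesis using gen by (auto simp: operator_graph_def blinfun.bilinear_simps)
  qed
  have comm_J: "endo (U s) * J a = J a * endo (U s)" if s: "0 \<le> s" for s a
  proof (cases "0 < a")
    case a: True
    show ?thesis
    proof (rule endo_eqI)
      fix x
      let ?y = "app (J a) x"
      have "blinfun_apply (U s) x = blinfun_apply (U s) (?y + a *\<^sub>R H ?y)" by (simp add: J_right a)
      also have "\<dots> = blinfun_apply (U s) ?y + a *\<^sub>R H (blinfun_apply (U s) ?y)"
        using inv[OF J_in_D[OF a] s] by (simp add: blinfun.bilinear_simps)
      finally have "app (J a) (blinfun_apply (U s) x) = blinfun_apply (U s) ?y"
        using J_left[OF a, of "blinfun_apply (U s) ?y"] inv[OF J_in_D[OF a] s, of x] by metis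
      then show "app (endo (U s) * J a) x = app (J a * endo (U s)) x" by (simp add: app_endo)
    qed
  qed (simp add: J_def)
  have comm_T: "endo (U s) * T r = T r * endo (U s)" if "0 \<le> s" "0 \<le> r" for s r
  proof (rule LIMSEQ_unique)
    show "(\<lambda>n. endo (U s) * euler r n) \<longlonglongrightarrow> endo (U s) * T r"
      by (intro tendsto_mult tendsto_const euler_tendsto_T that)
    have "endo (U s) * euler r n = euler r n * endo (U s)" for n
      unfolding euler_def by (rule power_comm_mult[symmetric]) (rule comm_J[OF that(1), symmetric])
    then show "(\<lambda>n. endo (U s) * euler r n) \<longlonglongrightarrow> T r * endo (U s)"
      by (simp only:) (intro tendsto_mult tendsto_const euler_tendsto_T that)
  qed
  obtain B where B: "0 \<le> B" "\<And>s. 0 \<le> s \<Longrightarrow> s \<le> t \<Longrightarrow> norm (U s) \<le> B"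
    using C0_semigroup_bounded[OF U, of t] by blast
  have "endo (U t) = T t"
  proof (cases "t = 0")
    case True
    then show ?thesis using U by (simp add: C0_semigroup_def one_endo_def)
  next
    case False
    then have t: "0 < t" using t by simp
    show ?thesis
    proof (rule endo_eq_if_eq_on_D)
      fix x assume x: "x \<in> D"
      define g where "g h = (1 / h) *\<^sub>R (blinfun_apply (U h) x - x) - (1 / h) *\<^sub>R (app (T h) x - x)" for h
      have "(g \<longlongrightarrow> - H x - - H x) (at_right 0)"
        unfolding g_def by (intro tendsto_diff U_deriv T_derivative x)
      then have g: "(g \<longlongrightarrow> 0) (at_right 0)" by simp
      have "norm (app (endo (U t)) x - app (T t) x) \<le> B * t * norm (g (t / real n))" if n: "1 \<le> n" for n
      proof -
        define h where "h = t / real n"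
        have h: "0 < h" "real n * h = t" using t n by (auto simp: h_def)
        have "C0_semigroup (\<lambda>t. blin (T t))" by (rule C0_semigroup_T)
        then have Tn: "T t = T h ^ n"
          using C0_semigroup_multiple[of "\<lambda>t. blin (T t)" h n] h by (simp add: blin_inverse)
        have Un: "endo (U t) = endo (U h) ^ n"
          using C0_semigroup_multiple[OF U, of h n] h by simp
        have Ub: "norm (endo (U h) ^ k) \<le> B" if k: "k < n" for k
        proof -
          have "real k * h \<le> real n * h" using k h by (intro mult_right_mono) auto
          then have "norm (U (real k * h)) \<le> B" using h by (intro B) auto
          then show ?thesis using C0_semigroup_multiple[OF U, of h k] h by (simp flip: norm_endo_eq)
        qed
        have "norm (app (endo (U t)) x - app (T t) x) \<le> real n * (B * norm (app (endo (U h)) x - app (T h) x))"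
          unfolding Tn Un
          using h by (intro norm_power_diff_app_le comm_T Ub norm_T) auto
        also have "app (endo (U h)) x - app (T h) x = h *\<^sub>R g h"
          using h by (simp add: g_def app_endo scaleR_diff_right)
        also have "real n * (B * norm (h *\<^sub>R g h)) = B * (real n * h) * norm (g h)"
          using h(1) by (simp add: mult_ac)
        finally show ?thesis by (simp add: h) (simp add: h_def)
      qed
      then have le: "\<exists>N. \<forall>n\<ge>N. norm (app (endo (U t)) x - app (T t) x) \<le> B * t * norm (g (t / real n))"
        by blast
      have "filterlim (\<lambda>n. t / real n) (at_right 0) sequentially"
        unfolding filterlim_at using t lim_const_over_n[of t]
        by (auto simp: eventually_sequentially intro!: exI[of _ 1])
      then have "(\<lambda>n. g (t / real n)) \<longlonglongrightarrow> 0" by (rule filterlim_compose[OF g])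
      then have "(\<lambda>n. B * t * norm (g (t / real n))) \<longlonglongrightarrow> B * t * norm (0::'a)" by (intro tendsto_intros)
      then have "norm (app (endo (U t)) x - app (T t) x) \<le> B * t * norm (0::'a)"
        by (rule LIMSEQ_le_const[OF _ le])
      then show "app (endo (U t)) x = app (T t) x" by simp
    qed
  qed
  then show ?thesis by (metis UNIV_I endo_inverse)
qed

lemma exp_minus_eq_T:
  assumes "0 \<le> t"
  shows "exp_minus D H t = blin (T t)"
  unfolding exp_minus_def
proof (rule the_equality)
  show "\<exists>U. C0_semigroup U \<and> generator_graph U = operator_graph D (\<lambda>x. - H x) \<and> blin (T t) = U t"
    using C0_semigroup_T generator_graph_T by blast
  show "B = blin (T t)"
    if "\<exists>U. C0_semigroup U \<and> generator_graph U = operator_graph D (\<lambda>x. - H x) \<and> B = U t" for B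
    using that semigroup_unique assms by blast
qed

end

section \<open>Chernoff approximation\<close>

context nonneg_self_adjoint
begin

lemma bounded_inverse_eq_J:
  assumes t: "0 < t"
  shows "bounded_inverse D (\<lambda>x. x + t *\<^sub>R H x) = blin (J t)"
  unfolding bounded_inverse_def
proof (rule the_equality)
  let ?J = "blinfun_apply (blin (J t))"
  show "(\<forall>y. ?J y \<in> D \<and> ?J y + t *\<^sub>R H (?J y) = y) \<and> (\<forall>x\<in>D. ?J (x + t *\<^sub>R H x) = x)"
    using J_in_D[OF t] J_right[OF t] J_left[OF t] by (simp add: app_def)
  show "B = blin (J t)"
    if B: "(\<forall>y. blinfun_apply B y \<in> D \<and> blinfun_apply B y + t *\<^sub>R H (blinfun_apply B y) = y) \<and>
      (\<forall>x\<in>D. blinfun_apply B (x + t *\<^sub>R H x) = x)" for B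
  proof (rule blinfun_eqI)
    fix y
    have "app (J t) (blinfun_apply B y + t *\<^sub>R H (blinfun_apply B y)) = blinfun_apply B y"
      using B by (intro J_left t) auto
    then show "blinfun_apply B y = blinfun_apply (blin (J t)) y" using B by (simp add: app_def)
  qed
qed

text \<open>
  The bound is the sum of \<open>54\<close> times the distance of the resolvents of \<open>n (1 - F)\<close> and
  \<open>n (1 - J (t / n))\<close> and of the error \<open>108 / n\<close> of the Euler scheme.
\<close>

lemma norm_power_minus_T:
  assumes F: "pos_contraction F" and t: "0 < t" and n: "0 < n"
    and R: "R * (1 + real n *\<^sub>R (1 - F)) = 1" "(1 + real n *\<^sub>R (1 - F)) * R = 1"
  shows "norm (F ^ n - T t) \<le> 54 * norm (R - J t) + 162 / real n"
proof -
  define G where "G = J (t / real n)"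
  have G: "pos_contraction G" by (simp add: G_def J_pos_contraction)
  then have "pos_op (real n *\<^sub>R (1 - G))" by (auto simp: pos_contraction_def intro: positive_scaleR)
  then obtain Q where Q: "pos_contraction Q" "Q * (1 + real n *\<^sub>R (1 - G)) = 1" "(1 + real n *\<^sub>R (1 - G)) * Q = 1"
    using resolvent_exists by blast
  have "norm (Q - J (real n * (t / real n))) \<le> 1 / real n"
    by (rule norm_resolvent_step_diff[of "t / real n" 1]) (use Q n t in \<open>simp_all add: G_def\<close>)
  then have QJ: "norm (Q - J t) \<le> 1 / real n" using n by simp
  have "norm (F ^ n - T t) \<le> norm (F ^ n - G ^ n) + norm (G ^ n - T t)"
    using norm_triangle_ineq[of "F ^ n - G ^ n" "G ^ n - T t"] by simp
  also have "norm (F ^ n - G ^ n) \<le> 54 * norm (R - Q)"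
    by (rule norm_power_diff_le_resolvent_diff[OF F G n R Q(2,3)])
  also have "norm (R - Q) \<le> norm (R - J t) + norm (Q - J t)"
    using norm_triangle_ineq4[of "R - J t" "Q - J t"] by simp
  also have "norm (G ^ n - T t) \<le> 108 / real n"
    using norm_euler_minus_T[of t n] t n by (simp add: G_def euler_def)
  finally show ?thesis using QJ by simp
qed

text \<open>
  With \<open>V\<^sub>t = (1 + t A)\<^sup>-\<^sup>1\<close> one has \<open>J t - V\<^sub>t = t P (J 1 - V\<^sub>1) L\<close>, where
  \<open>P = (1 + A) (1 + t A)\<^sup>-\<^sup>1\<close> and \<open>L = (1 + H) (1 + t H)\<^sup>-\<^sup>1\<close> are contractions for \<open>t \<ge> 1\<close>, being
  convex combinations of the identity and a contraction.
\<close>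

lemma norm_resolvent_diff_rescale:
  assumes t: "1 \<le> t"
    and V1: "V1 * (1 + A) = 1" "(1 + A) * V1 = 1"
    and Vt: "Vt * (1 + t *\<^sub>R A) = 1" "norm Vt \<le> 1"
  shows "norm (Vt - J t) \<le> t * norm (V1 - J 1)"
proof -
  have convex: "norm ((1 / t) *\<^sub>R 1 + (1 - 1 / t) *\<^sub>R V) \<le> 1" if "norm V \<le> 1" for V :: "'a endo"
  proof -
    have "norm ((1 / t) *\<^sub>R 1 + (1 - 1 / t) *\<^sub>R V) \<le> (1 / t) * norm (1 :: 'a endo) + (1 - 1 / t) * norm V"
      using t norm_triangle_ineq[of "(1 / t) *\<^sub>R 1" "(1 - 1 / t) *\<^sub>R V"] by simp
    also have "\<dots> \<le> (1 / t) * 1 + (1 - 1 / t) * 1"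
      using t that by (intro add_mono mult_left_mono norm_one_endo_le) auto
    finally show ?thesis by simp
  qed
  define P where "P = (1 / t) *\<^sub>R 1 + (1 - 1 / t) *\<^sub>R Vt"
  define L where "L = (1 / t) *\<^sub>R 1 + (1 - 1 / t) *\<^sub>R J t"
  have tVA: "t *\<^sub>R (Vt * A) = 1 - Vt" using Vt(1) by (simp add: algebra_simps)
  have "Vt * A = (1 / t) *\<^sub>R (t *\<^sub>R (Vt * A))" using t by simp
  then have VA: "Vt * A = (1 / t) *\<^sub>R (1 - Vt)" by (simp only: tVA)
  have "P = Vt * (1 + A)"
    by (simp add: P_def VA distrib_left scaleR_diff_right scaleR_diff_left)
  then have PV1: "P * V1 = Vt" by (simp add: mult.assoc V1)
  have JL: "J 1 * L = J t"
  proof -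
    have "1 *\<^sub>R (J 1 * (1 - J t)) = t *\<^sub>R ((1 - J 1) * J t)" using t by (intro J_resolvent) auto
    then have "(1 / t) *\<^sub>R (J 1 * (1 - J t)) = (1 - J 1) * J t" using t by simp
    moreover have "J 1 * L = J 1 * J t + (1 / t) *\<^sub>R (J 1 * (1 - J t))"
      by (simp add: L_def algebra_simps)
    ultimately show ?thesis by (simp add: left_diff_distrib)
  qed
  have "P * (J 1 - V1) * L = P * (J 1 * L) - (P * V1) * L" by (simp add: algebra_simps)
  also have "\<dots> = P * J t - Vt * L" by (simp add: PV1 JL)
  also have "\<dots> = (1 / t) *\<^sub>R (J t - Vt)" by (simp add: P_def L_def algebra_simps)
  finally have eq: "(1 / t) *\<^sub>R (J t - Vt) = P * (J 1 - V1) * L" by simp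
  have "(1 / t) * norm (J t - Vt) = norm (P * (J 1 - V1) * L)" using t by (simp flip: eq)
  also have "\<dots> \<le> norm (J 1 - V1)"
    unfolding P_def L_def
    by (intro norm_mult_le_right norm_mult_le_left convex Vt norm_J order_refl)
  finally show ?thesis using t by (simp add: field_simps norm_minus_commute)
qed

end

lemma pos_op_endo:
  assumes "self_adjoint UNIV (blinfun_apply A)" "nonneg_operator UNIV (blinfun_apply A)"
  shows "pos_op (endo A)"
proof -
  interpret A: nonneg_self_adjoint UNIV "blinfun_apply A" by standard (rule assms)+
  show ?thesis using A.H_symmetric A.H_nonneg by (simp add: pos_op_def hermitian_def app_endo)
qed

theorem theorem3p3:
  fixes F S :: "real \<Rightarrow> ('a::complex_hilbert_space \<Rightarrow>\<^sub>L 'a)"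
    and D :: "'a set" and H :: "'a \<Rightarrow> 'a"
    and \<rho> M :: real and I :: "real set"
  assumes "measurable_family F"
    and "\<And>\<tau>. \<tau> \<ge> 0 \<Longrightarrow> self_adjoint UNIV (blinfun_apply (F \<tau>))"
    and "\<And>\<tau>. \<tau> \<ge> 0 \<Longrightarrow> nonneg_operator UNIV (blinfun_apply (F \<tau>))"
    and "\<And>\<tau>. \<tau> \<ge> 0 \<Longrightarrow> norm (F \<tau>) \<le> 1"
    and "F 0 = id_blinfun"
    and "\<And>\<tau>. \<tau> > 0 \<Longrightarrow> S \<tau> = (1 / \<tau>) *\<^sub>R (id_blinfun - F \<tau>)"
    and "self_adjoint D H" and "nonneg_operator D H"
    and "limitin strong_operator_topology
           (\<lambda>\<tau>. bounded_inverse UNIV (\<lambda>x. x + blinfun_apply (S \<tau>) x))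
           (bounded_inverse D (\<lambda>x. x + H x)) (at_right 0)"
    and "0 < \<rho>" and "\<rho> \<le> 1" and "M > 0"
    and "\<And>\<tau> t. 0 < \<tau> \<Longrightarrow> \<tau> \<le> t \<Longrightarrow> t \<le> 1 \<Longrightarrow>
           norm (bounded_inverse UNIV (\<lambda>x. x + t *\<^sub>R blinfun_apply (S \<tau>) x) -
                 bounded_inverse D (\<lambda>x. x + t *\<^sub>R H x)) \<le> M * (\<tau> / t) powr \<rho>"
    and "is_interval I" and "bounded I" and "I \<subseteq> {0..}"
  shows "\<exists>c>0. \<forall>n::nat. n \<ge> 1 \<longrightarrow>
           (SUP t\<in>I. ennreal (norm (blinfun_power (F (t / real n)) n - exp_minus D H t)))
             \<le> ennreal (c * (1 / real n powr \<rho>))"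
proof -
  interpret H: nonneg_self_adjoint D H by standard (rule assms(7,8))+
  note F_sa = assms(2,3) and F_norm = assms(4) and F_0 = assms(5) and S_eq = assms(6)
  note \<rho> = \<open>0 < \<rho>\<close> \<open>\<rho> \<le> 1\<close> and M = \<open>M > 0\<close> and res = assms(13)
  define F' where "F' \<tau> = endo (F \<tau>)" for \<tau>
  have F': "pos_contraction (F' \<tau>)" if "0 \<le> \<tau>" for \<tau>
    using F_sa[OF that] F_norm[OF that]
    by (auto simp: F'_def norm_endo_eq intro!: pos_contractionI pos_op_endo)
  define A where "A \<tau> = (1 / \<tau>) *\<^sub>R (1 - F' \<tau>)" for \<tau>
  have A_S: "app (A \<tau>) = blinfun_apply (S \<tau>)" if "0 < \<tau>" for \<tau>
    by (rule ext) (simp add: A_def F'_def S_eq[OF that] app_simps app_endo blinfun.bilinear_simps)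
  have A_pos: "pos_op (A \<tau>)" if "0 < \<tau>" for \<tau>
    using F'[of \<tau>] that unfolding A_def by (intro positive_scaleR) (auto simp: pos_contraction_def)
  have resolvent: "\<exists>V. norm V \<le> 1 \<and> V * (1 + t *\<^sub>R A \<tau>) = 1 \<and> (1 + t *\<^sub>R A \<tau>) * V = 1 \<and>
      blin V = bounded_inverse UNIV (\<lambda>x. x + t *\<^sub>R blinfun_apply (S \<tau>) x)"
    if "0 < \<tau>" "0 < t" for t \<tau>
  proof -
    interpret A: nonneg_self_adjoint UNIV "app (A \<tau>)"
      by (rule full_domain_nonneg_self_adjoint[OF A_pos]) fact
    have "A.J t * (1 + t *\<^sub>R A \<tau>) = 1"
      by (rule endo_eqI) (use A.J_left[OF \<open>0 < t\<close>] in \<open>simp add: app_simps\<close>)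
    moreover have "(1 + t *\<^sub>R A \<tau>) * A.J t = 1"
      by (rule endo_eqI) (use A.J_right[OF \<open>0 < t\<close>] in \<open>simp add: app_simps\<close>)
    ultimately show ?thesis
      using A.norm_J[of t] A.bounded_inverse_eq_J[OF \<open>0 < t\<close>] A_S[OF that(1)] by auto
  qed
  have norm_blin_diff: "norm (blin X - blin Y) = norm (X - Y)" for X Y :: "'a endo"
    by (simp add: minus_endo.rep_eq norm_endo.rep_eq)
  obtain N0 where N0: "\<And>t. t \<in> I \<Longrightarrow> \<bar>t\<bar> \<le> N0" using \<open>bounded I\<close> by (auto simp: bounded_real)
  define N where "N = max 1 N0"
  have N1: "1 \<le> N" and N: "\<And>t. t \<in> I \<Longrightarrow> t \<le> N" using N0 by (force simp: N_def)+
  \<comment> \<open>The first two terms cover \<open>t \<le> n\<close>, the last one \<open>n < t\<close>.\<close>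
  define c where "c = 54 * (M * N * N powr \<rho>) + 162 + 2 * N powr \<rho>"
  have NN: "1 \<le> N * N powr \<rho>" "1 \<le> N powr \<rho>"
    using N1 \<rho> mult_mono[of 1 N 1 "N powr \<rho>"] by (auto simp: ge_one_powr_ge_zero)
  have c: "0 < c" using M N1 by (simp add: c_def add_pos_nonneg)
  have key: "norm (F' (t / real n) ^ n - H.T t) \<le> c * (1 / real n powr \<rho>)"
    if tI: "t \<in> I" and n: "1 \<le> n" for t and n :: nat
  proof -
    have t0: "0 \<le> t" using tI \<open>I \<subseteq> {0..}\<close> by auto
    have n0: "0 < real n" using n by simp
    have np: "0 < real n powr \<rho>" using n0 by simp
    consider "t = 0" | "real n < t" | "0 < t" "t \<le> real n" using t0 by linarith
    then show ?thesis
    proof cases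
      case 1
      then show ?thesis using F_0 c by (simp add: F'_def flip: one_endo_def)
    next
      case 2
      have "norm (F' (t / real n) ^ n - H.T t) \<le> norm (F' (t / real n) ^ n) + norm (H.T t)"
        by (rule norm_triangle_ineq4)
      also have "\<dots> \<le> 1 + 1"
        using t0 by (intro add_mono norm_power_endo_le pos_contraction_norm F' H.norm_T) auto
      also have "\<dots> \<le> 2 * (N powr \<rho> / real n powr \<rho>)"
      proof -
        have "real n powr \<rho> \<le> N powr \<rho>" using 2 N[OF tI] \<rho> by (intro powr_mono2) auto
        then show ?thesis using np by (simp add: field_simps)
      qed
      also have "\<dots> \<le> c * (1 / real n powr \<rho>)"
        using np M N1 by (simp add: c_def divide_right_mono)
      finally show ?thesis .
    next
      case 3
      define \<tau> where "\<tau> = t / real n"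
      have \<tau>: "0 < \<tau>" "\<tau> \<le> 1" "\<tau> \<le> t" using 3 n by (auto simp: \<tau>_def field_simps)
      obtain V where V: "norm V \<le> 1" "V * (1 + t *\<^sub>R A \<tau>) = 1" "(1 + t *\<^sub>R A \<tau>) * V = 1"
        "blin V = bounded_inverse UNIV (\<lambda>x. x + t *\<^sub>R blinfun_apply (S \<tau>) x)"
        using resolvent[OF \<tau>(1) 3(1)] by blast
      have VJ: "norm (V - H.J t) \<le> M * N * N powr \<rho> / real n powr \<rho>"
      proof (cases "t \<le> 1")
        case True
        have "norm (V - H.J t) \<le> M * (\<tau> / t) powr \<rho>"
          using res[OF \<tau>(1,3) True] by (simp add: V(4)[symmetric] H.bounded_inverse_eq_J 3 norm_blin_diff)
        also have "(\<tau> / t) powr \<rho> = 1 / real n powr \<rho>"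
          using 3 n0 by (simp add: \<tau>_def powr_divide)
        also have "M * (1 / real n powr \<rho>) \<le> M * (N * N powr \<rho> / real n powr \<rho>)"
          using NN np M by (intro mult_left_mono divide_right_mono) auto
        finally show ?thesis by (simp add: mult.assoc)
      next
        case False
        then have t1: "1 \<le> t" by simp
        obtain V1 where V1: "V1 * (1 + 1 *\<^sub>R A \<tau>) = 1" "(1 + 1 *\<^sub>R A \<tau>) * V1 = 1"
          "blin V1 = bounded_inverse UNIV (\<lambda>x. x + 1 *\<^sub>R blinfun_apply (S \<tau>) x)"
          using resolvent[OF \<tau>(1), of 1] by auto
        have "norm (V - H.J t) \<le> t * norm (V1 - H.J 1)"
          using V V1 by (intro H.norm_resolvent_diff_rescale[OF t1]) auto
        also have "norm (V1 - H.J 1) \<le> M * (\<tau> / 1) powr \<rho>"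
          using res[OF \<tau>(1,2)] H.bounded_inverse_eq_J[of 1] V1(3) by (simp flip: norm_blin_diff)
        also have "t * (M * (\<tau> / 1) powr \<rho>) = t * M * (t powr \<rho> / real n powr \<rho>)"
          using 3 n0 by (simp add: \<tau>_def powr_divide)
        also have "\<dots> \<le> N * M * (N powr \<rho> / real n powr \<rho>)"
          using N[OF tI] 3 M \<rho> np by (intro mult_mono divide_right_mono powr_mono2) auto
        finally show ?thesis using t1 by (simp add: mult_ac mult_left_mono)
      qed
      have nA: "real n *\<^sub>R (1 - F' \<tau>) = t *\<^sub>R A \<tau>"
        using 3 n0 by (simp add: A_def \<tau>_def)
      have "norm (F' \<tau> ^ n - H.T t) \<le> 54 * norm (V - H.J t) + 162 / real n"
        using \<tau> n V by (intro H.norm_power_minus_T F' 3) (auto simp: nA)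
      also have "\<dots> \<le> 54 * (M * N * N powr \<rho> / real n powr \<rho>) + 162 / real n powr \<rho>"
      proof (intro add_mono mult_left_mono VJ divide_left_mono)
        show "real n powr \<rho> \<le> real n" using powr_mono[of \<rho> 1 "real n"] \<rho> n by simp
      qed (use n0 in auto)
      also have "\<dots> \<le> c * (1 / real n powr \<rho>)"
        using np N1 by (simp add: c_def add_divide_distrib)
      finally show ?thesis by (simp add: \<tau>_def)
    qed
  qed
  show ?thesis
  proof (intro exI[of _ c] conjI allI impI c SUP_least ennreal_leI)
    fix n :: nat and t assume n: "1 \<le> n" and tI: "t \<in> I"
    have "0 \<le> t" using tI \<open>I \<subseteq> {0..}\<close> by auto
    moreover have "blinfun_power (F (t / real n)) n = blin (F' (t / real n) ^ n)"
      by (simp add: blin_power F'_def endo_inverse)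
    ultimately show "norm (blinfun_power (F (t / real n)) n - exp_minus D H t) \<le> c * (1 / real n powr \<rho>)"
      using key[OF tI n] by (simp add: H.exp_minus_eq_T norm_blin_diff)
  qed
qed

end
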